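(* Let $H$ be a complex Hilbert space with open unit ball $B_H$, and let $\varphi:B_H\to B_H$ be holomorphic such that $\varphi(B_H)\subseteq rB_H$ for some $0<r<1$. Then, for the unique $a\in B_H$ such that $\varphi(a)=a$, we have $C_{\varphi^n}\to C_a$ as $n\to\infty$ in the topology of bounded convergence of $L(H_b(B_H))$. In particular, $(C_\varphi)_{[n]}\to C_a$ in this topology, and $C_\varphi:H_b(B_H)\to H_b(B_H)$ is uniformly mean ergodic.
   Context: A function is holomorphic if it is (complex) Fréchet differentiable at every point. A set $A\subseteq B_H$ is $B_H$-bounded if it is bounded and has positive distance to the boundary of $B_H$ (that is, $A\subseteq sB_H$ for some $0<s<1$). $H_b(B_H)$ is the space of all holomorphic functions $f:B_H\to\mathbb{C}$ that are bounded on every $B_H$-bounded set, with the topology $\tau_b$ of uniform convergence on $B_H$-bounded sets; it is a Fréchet space. $C_\psi(f)=f\circ\psi$ denotes the composition operator with symbol $\psi$, $\varphi^n$ is the $n$-th iterate of $\varphi$, and for $a\in B_H$, $C_a$ is the composition operator whose symbol is the constant function $a$, i.e. $C_a(f)$ is the constant function $f(a)$. A map $\varphi$ as in the claim has a unique fixed point in $B_H$ by the Earle–Hamilton fixed point theorem. For a locally convex Hausdorff space $E$, $L(E)$ is the space of continuous linear maps $E\to E$; the topology of bounded convergence of $L(E)$ is that of uniform convergence on bounded subsets of $E$. For $T\in L(E)$, $T_{[n]}=\frac1n\sum_{k=0}^{n-1}T^k$ ($T^0=\mathrm{id}$), and $T$ is uniformly mean ergodic if $(T_{[n]})_n$ converges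 in the topology of bounded convergence of $L(E)$. *)

theory Defs
  imports "HOL-Analysis.Analysis"
begin

section \<open>Complex vector spaces and complex Hilbert spaces\<close>

class complex_vector = real_vector +
  fixes scaleC :: "complex \<Rightarrow> 'a \<Rightarrow> 'a" (infixr "*\<^sub>C" 75)
  assumes scaleC_add_right: "c *\<^sub>C (x + y) = c *\<^sub>C x + c *\<^sub>C y"
    and scaleC_add_left: "(c + d) *\<^sub>C x = c *\<^sub>C x + d *\<^sub>C x"
    and scaleC_scaleC: "c *\<^sub>C d *\<^sub>C x = (c * d) *\<^sub>C x"
    and scaleC_one: "1 *\<^sub>C x = x"
    and scaleR_scaleC: "r *\<^sub>R x = complex_of_real r *\<^sub>C x"

class complex_normed_vector = complex_vector + real_normed_vector +
  assumes norm_scaleC: "norm (c *\<^sub>C x) = cmod c * norm x"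

class complex_inner = complex_normed_vector +
  fixes cinner :: "'a \<Rightarrow> 'a \<Rightarrow> complex"
  assumes cinner_commute: "cinner x y = cnj (cinner y x)"
    and cinner_add_left: "cinner (x + y) z = cinner x z + cinner y z"
    and cinner_scaleC_left: "cinner (c *\<^sub>C x) y = c * cinner x y"
    and cinner_self: "cinner x x = complex_of_real ((norm x)\<^sup>2)"

class complex_hilbert = complex_inner + complete_space

instantiation complex :: complex_hilbert
begin

definition scaleC_complex_def: "c *\<^sub>C (x::complex) = c * x"
definition cinner_complex_def: "cinner x (y::complex) = x * cnj y"

instance
proof
  fix x y z c d :: complex and r :: real
  show "c *\<^sub>C (x + y) = c *\<^sub>C x + c *\<^sub>C y" "(c + d) *\<^sub>C x = c *\<^sub>C x + d *\<^sub>C x"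
    "c *\<^sub>C d *\<^sub>C x = (c * d) *\<^sub>C x" "1 *\<^sub>C x = x"
    by (simp_all add: scaleC_complex_def distrib_left distrib_right)
  show "r *\<^sub>R x = complex_of_real r *\<^sub>C x"
    by (simp add: scaleC_complex_def scaleR_conv_of_real)
  show "norm (c *\<^sub>C x) = cmod c * norm x"
    by (simp add: scaleC_complex_def norm_mult)
  show "cinner x y = cnj (cinner y x)" "cinner (x + y) z = cinner x z + cinner y z"
    "cinner (c *\<^sub>C x) y = c * cinner x y"
    by (simp_all add: cinner_complex_def scaleC_complex_def distrib_right)
  show "cinner x x = complex_of_real ((norm x)\<^sup>2)"
    unfolding cinner_complex_def by (rule complex_norm_square[symmetric])
qed

end

definition complex_linear :: "('a::complex_vector \<Rightarrow> 'b::complex_vector) \<Rightarrow> bool" where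
  "complex_linear T \<longleftrightarrow>
     (\<forall>x y. T (x + y) = T x + T y) \<and> (\<forall>c x. T (c *\<^sub>C x) = c *\<^sub>C T x)"

text \<open>Complex Frechet differentiability at each point of \<open>U\<close>, which is meant to be open:
  boundedness of the derivative is part of \<open>has_derivative\<close>.\<close>

definition frechet_holomorphic_on ::
    "('a::complex_normed_vector \<Rightarrow> 'b::complex_normed_vector) \<Rightarrow> 'a set \<Rightarrow> bool" where
  "frechet_holomorphic_on f U \<longleftrightarrow>
     (\<forall>x\<in>U. \<exists>D. complex_linear D \<and> (f has_derivative D) (at x))"


section \<open>Locally convex Hausdorff spaces and the topology of bounded convergence\<close>

class topological_complex_vector_t2 = complex_vector + t2_space + topological_group_add +
  assumes tendsto_scaleC_Pair: "LIM p (nhds c \<times>\<^sub>F nhds x). fst p *\<^sub>C snd p :> nhds (c *\<^sub>C x)"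

class locally_convex_t2 = topological_complex_vector_t2 +
  assumes locally_convex_zero:
      "open U \<Longrightarrow> 0 \<in> U \<Longrightarrow> \<exists>V W. open W \<and> 0 \<in> W \<and> W \<subseteq> V \<and> V \<subseteq> U \<and>
        (\<forall>x\<in>V. \<forall>y\<in>V. \<forall>u\<ge>0. \<forall>v\<ge>0. u + v = 1 \<longrightarrow> u *\<^sub>R x + v *\<^sub>R y \<in> V)"

definition lcs_bounded :: "'e::locally_convex_t2 set \<Rightarrow> bool" where
  "lcs_bounded B \<longleftrightarrow>
     (\<forall>U. open U \<and> 0 \<in> U \<longrightarrow> (\<exists>t>0. \<forall>s\<ge>t. B \<subseteq> (\<lambda>x. s *\<^sub>R x) ` U))"

lemma lcs_bounded_empty: "lcs_bounded {}"
  by (auto simp: lcs_bounded_def intro: exI[of _ 1])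

lemma lcs_bounded_Un:
  assumes "lcs_bounded A" "lcs_bounded B"
  shows "lcs_bounded (A \<union> B)"
  unfolding lcs_bounded_def
proof (intro allI impI)
  fix U :: "'a set" assume U: "open U \<and> 0 \<in> U"
  obtain t where t: "t > 0" "\<And>s. s \<ge> t \<Longrightarrow> A \<subseteq> (\<lambda>x. s *\<^sub>R x) ` U"
    using assms(1) U unfolding lcs_bounded_def by meson
  obtain u where u: "u > 0" "\<And>s. s \<ge> u \<Longrightarrow> B \<subseteq> (\<lambda>x. s *\<^sub>R x) ` U"
    using assms(2) U unfolding lcs_bounded_def by meson
  show "\<exists>t>0. \<forall>s\<ge>t. A \<union> B \<subseteq> (\<lambda>x. s *\<^sub>R x) ` U"
    using t u by (intro exI[of _ "max t u"]) auto
qed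

definition continuous_operators :: "('e::locally_convex_t2 \<Rightarrow> 'e) set" where
  "continuous_operators = {T. complex_linear T \<and> continuous_on UNIV T}"

text \<open>The sets \<open>{S. \<forall>x\<in>B. S x - T x \<in> U}\<close>, with \<open>B\<close> bounded and \<open>U\<close> a neighbourhood of
  zero, form a neighbourhood base at \<open>T\<close>. They are directed, as finite unions of bounded sets
  are bounded.\<close>

definition bounded_convergence_open :: "('e::locally_convex_t2 \<Rightarrow> 'e) set \<Rightarrow> bool" where
  "bounded_convergence_open W \<longleftrightarrow> W \<subseteq> continuous_operators \<and>
     (\<forall>T\<in>W. \<exists>B U. lcs_bounded B \<and> open U \<and> 0 \<in> U \<and>
        {S \<in> continuous_operators. \<forall>x\<in>B. S x - T x \<in> U} \<subseteq> W)"

definition bounded_convergence_topology :: "('e::locally_convex_t2 \<Rightarrow> 'e) topology" where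
  "bounded_convergence_topology = topology bounded_convergence_open"

lemma istopology_bounded_convergence_open: "istopology bounded_convergence_open"
  unfolding istopology_def
proof (intro conjI allI impI)
  fix V W :: "('a \<Rightarrow> 'a) set"
  assume V: "bounded_convergence_open V" and W: "bounded_convergence_open W"
  show "bounded_convergence_open (V \<inter> W)"
    unfolding bounded_convergence_open_def
  proof (intro conjI ballI)
    show "V \<inter> W \<subseteq> continuous_operators"
      using V by (auto simp: bounded_convergence_open_def)
    fix T assume T: "T \<in> V \<inter> W"
    obtain A P where A: "lcs_bounded A" "open P" "0 \<in> P"
        "{S \<in> continuous_operators. \<forall>x\<in>A. S x - T x \<in> P} \<subseteq> V"
      using V T unfolding bounded_convergence_open_def by blast
    obtain B Q where B: "lcs_bounded B" "open Q" "0 \<in> Q"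
        "{S \<in> continuous_operators. \<forall>x\<in>B. S x - T x \<in> Q} \<subseteq> W"
      using W T unfolding bounded_convergence_open_def by blast
    show "\<exists>B U. lcs_bounded B \<and> open U \<and> 0 \<in> U \<and>
        {S \<in> continuous_operators. \<forall>x\<in>B. S x - T x \<in> U} \<subseteq> V \<inter> W"
      using A B by (intro exI[of _ "A \<union> B"] exI[of _ "P \<inter> Q"]) (auto simp: lcs_bounded_Un)
  qed
next
  fix K :: "('a \<Rightarrow> 'a) set set"
  assume K: "\<forall>W\<in>K. bounded_convergence_open W"
  show "bounded_convergence_open (\<Union>K)"
    unfolding bounded_convergence_open_def
  proof (intro conjI ballI)
    show "\<Union>K \<subseteq> continuous_operators"
      using K by (auto simp: bounded_convergence_open_def)
    fix T assume "T \<in> \<Union>K"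
    then obtain W where W: "W \<in> K" "T \<in> W" by blast
    then obtain B U where "lcs_bounded B" "open U" "0 \<in> U"
        "{S \<in> continuous_operators. \<forall>x\<in>B. S x - T x \<in> U} \<subseteq> W"
      using K unfolding bounded_convergence_open_def by blast
    with W show "\<exists>B U. lcs_bounded B \<and> open U \<and> 0 \<in> U \<and>
        {S \<in> continuous_operators. \<forall>x\<in>B. S x - T x \<in> U} \<subseteq> \<Union>K"
      by (intro exI[of _ B] exI[of _ U]) auto
  qed
qed

lemma openin_bounded_convergence_topology:
  "openin bounded_convergence_topology W \<longleftrightarrow> bounded_convergence_open W"
  by (simp add: bounded_convergence_topology_def topology_inverse'
      istopology_bounded_convergence_open)

lemma topspace_bounded_convergence_topology:
  "topspace bounded_convergence_topology = continuous_operators"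
proof
  show "topspace bounded_convergence_topology \<subseteq> continuous_operators"
    using openin_topspace[of bounded_convergence_topology]
    unfolding openin_bounded_convergence_topology bounded_convergence_open_def by (rule conjunct1)
  have "bounded_convergence_open continuous_operators"
    unfolding bounded_convergence_open_def
    by (intro conjI ballI exI[of _ "{}"] exI[of _ UNIV]) (auto simp: lcs_bounded_empty)
  then show "continuous_operators \<subseteq> topspace bounded_convergence_topology"
    by (intro openin_subset) (simp add: openin_bounded_convergence_topology)
qed

text \<open>For \<open>n = 0\<close> this is the zero operator; only \<open>n \<ge> 1\<close> is of interest.\<close>

definition cesaro_mean :: "('e::complex_vector \<Rightarrow> 'e) \<Rightarrow> nat \<Rightarrow> 'e \<Rightarrow> 'e" where
  "cesaro_mean T n = (\<lambda>x. (1 / real n) *\<^sub>R (\<Sum>k<n. (T ^^ k) x))"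

definition uniformly_mean_ergodic :: "('e::locally_convex_t2 \<Rightarrow> 'e) \<Rightarrow> bool" where
  "uniformly_mean_ergodic T \<longleftrightarrow> T \<in> continuous_operators \<and>
     (\<exists>P. limitin bounded_convergence_topology (cesaro_mean T) P sequentially)"


section \<open>The space of holomorphic functions of bounded type on the unit ball\<close>

definition ball_bounded :: "'h::real_normed_vector set \<Rightarrow> bool" where
  "ball_bounded A \<longleftrightarrow> (\<exists>s. 0 < s \<and> s < 1 \<and> A \<subseteq> ball 0 s)"

lemma ball_bounded_Un: "ball_bounded A \<Longrightarrow> ball_bounded B \<Longrightarrow> ball_bounded (A \<union> B)"
  unfolding ball_bounded_def
proof (elim exE conjE)
  fix s t :: real assume "0 < s" "s < 1" "A \<subseteq> ball 0 s" "0 < t" "t < 1" "B \<subseteq> ball 0 t"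
  then show "\<exists>s>0. s < 1 \<and> A \<union> B \<subseteq> ball 0 s"
    by (intro exI[of _ "max s t"]) auto
qed

lemma ball_bounded_empty: "ball_bounded {}"
  unfolding ball_bounded_def by (intro exI[of _ "1/2"]) auto

lemma ball_bounded_singleton: "x \<in> ball 0 1 \<Longrightarrow> ball_bounded {x}"
  unfolding ball_bounded_def using dense[of "norm x" 1]
  by (auto, metis le_less_trans norm_ge_zero)

lemma ball_bounded_subset: "ball_bounded A \<Longrightarrow> A \<subseteq> ball 0 1"
  unfolding ball_bounded_def by auto

text \<open>Functions on the open unit ball are represented by their extension by zero.\<close>

definition hb_functions :: "('h::complex_hilbert \<Rightarrow> complex) set" where
  "hb_functions = {f. frechet_holomorphic_on f (ball 0 1) \<and>
     (\<forall>A. ball_bounded A \<longrightarrow> bounded (f ` A)) \<and> (\<forall>x. x \<notin> ball 0 1 \<longrightarrow> f x = 0)}"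

lemma hb_functionsI:
  assumes "\<And>x. x \<in> ball 0 1 \<Longrightarrow> \<exists>D. complex_linear D \<and> (f has_derivative D) (at x)"
    and "\<And>A. ball_bounded A \<Longrightarrow> bounded (f ` A)"
    and "\<And>x. x \<notin> ball 0 1 \<Longrightarrow> f x = 0"
  shows "f \<in> hb_functions"
  unfolding hb_functions_def frechet_holomorphic_on_def using assms by blast

lemma hb_functionsD:
  assumes "f \<in> hb_functions"
  shows "x \<in> ball 0 1 \<Longrightarrow> \<exists>D. complex_linear D \<and> (f has_derivative D) (at x)"
    and "ball_bounded A \<Longrightarrow> bounded (f ` A)"
    and "x \<notin> ball 0 1 \<Longrightarrow> f x = 0"
proof -
  have "frechet_holomorphic_on f (ball 0 1)"
      "\<forall>A. ball_bounded A \<longrightarrow> bounded (f ` A)" "\<forall>x. x \<notin> ball 0 1 \<longrightarrow> f x = 0"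
    using assms unfolding hb_functions_def by simp_all
  then show "x \<in> ball 0 1 \<Longrightarrow> \<exists>D. complex_linear D \<and> (f has_derivative D) (at x)"
    "ball_bounded A \<Longrightarrow> bounded (f ` A)" "x \<notin> ball 0 1 \<Longrightarrow> f x = 0"
    unfolding frechet_holomorphic_on_def by blast+
qed

lemma hb_functions_zero: "(\<lambda>_. 0) \<in> hb_functions"
  by (auto simp: hb_functions_def frechet_holomorphic_on_def complex_linear_def scaleC_complex_def
      image_constant_conv intro!: exI[of _ "\<lambda>_. 0"])

lemma hb_functions_add:
  assumes f: "f \<in> hb_functions" and g: "g \<in> hb_functions"
  shows "(\<lambda>x. f x + g x) \<in> hb_functions"
proof (rule hb_functionsI)
  fix x :: 'a assume x: "x \<in> ball 0 1"
  obtain D where D: "complex_linear D" "(f has_derivative D) (at x)"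
    using hb_functionsD(1)[OF f x] by blast
  obtain E where E: "complex_linear E" "(g has_derivative E) (at x)"
    using hb_functionsD(1)[OF g x] by blast
  have "complex_linear (\<lambda>v. D v + E v)"
    using D(1) E(1) by (simp add: complex_linear_def scaleC_add_right algebra_simps)
  then show "\<exists>D. complex_linear D \<and> ((\<lambda>x. f x + g x) has_derivative D) (at x)"
    using has_derivative_add[OF D(2) E(2)] by blast
qed (use f g in \<open>auto simp: hb_functionsD bounded_plus_comp simp del: mem_ball mem_ball_0\<close>)

lemma hb_functions_scale:
  assumes f: "f \<in> hb_functions"
  shows "(\<lambda>x. c * f x) \<in> hb_functions"
proof (rule hb_functionsI)
  fix x :: 'a assume x: "x \<in> ball 0 1"
  obtain D where D: "complex_linear D" "(f has_derivative D) (at x)"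
    using hb_functionsD(1)[OF f x] by blast
  have "complex_linear (\<lambda>v. c * D v)"
    using D(1) by (simp add: complex_linear_def scaleC_complex_def algebra_simps)
  then show "\<exists>D. complex_linear D \<and> ((\<lambda>x. c * f x) has_derivative D) (at x)"
    using has_derivative_mult_right[OF D(2), of c] by blast
next
  fix A :: "'a set" assume "ball_bounded A"
  then have "bounded ((\<lambda>z. c * z) ` f ` A)"
    by (intro bounded_linear_image bounded_linear_mult_right hb_functionsD(2)[OF f])
  then show "bounded ((\<lambda>x. c * f x) ` A)" by (simp add: image_image)
qed (use f in \<open>auto simp: hb_functionsD simp del: mem_ball mem_ball_0\<close>)

typedef (overloaded) 'h hb = "hb_functions :: ('h::complex_hilbert \<Rightarrow> complex) set"
  morphisms hb_apply Abs_hb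
  using hb_functions_zero by blast

lemma hb_eqI: "(\<And>x. hb_apply f x = hb_apply g x) \<Longrightarrow> f = g"
  by (metis ext hb_apply_inject)

instantiation hb :: (complex_hilbert) complex_vector
begin

definition zero_hb_def: "0 = Abs_hb (\<lambda>_. 0)"
definition plus_hb_def: "f + g = Abs_hb (\<lambda>x. hb_apply f x + hb_apply g x)"
definition scaleC_hb_def: "c *\<^sub>C f = Abs_hb (\<lambda>x. c * hb_apply f x)"
definition scaleR_hb_def: "r *\<^sub>R (f :: 'a hb) = complex_of_real r *\<^sub>C f"
definition uminus_hb_def: "- f = (-1) *\<^sub>C (f :: 'a hb)"
definition minus_hb_def: "f - g = f + (- g :: 'a hb)"

lemma hb_apply_zero: "hb_apply 0 x = 0"
  by (simp add: zero_hb_def Abs_hb_inverse hb_functions_zero)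

lemma hb_apply_add: "hb_apply (f + g) x = hb_apply f x + hb_apply g x"
  by (simp add: plus_hb_def Abs_hb_inverse hb_functions_add hb_apply)

lemma hb_apply_scaleC: "hb_apply (c *\<^sub>C f) x = c * hb_apply f x"
  by (simp add: scaleC_hb_def Abs_hb_inverse hb_functions_scale hb_apply)

lemma hb_apply_scaleR: "hb_apply (r *\<^sub>R f) x = of_real r * hb_apply f x"
  by (simp add: scaleR_hb_def hb_apply_scaleC)

lemma hb_apply_uminus: "hb_apply (- f) x = - hb_apply f x"
  by (simp add: uminus_hb_def hb_apply_scaleC)

lemma hb_apply_minus: "hb_apply (f - g) x = hb_apply f x - hb_apply g x"
  by (simp add: minus_hb_def hb_apply_add hb_apply_uminus)

instance
  by standard
    (auto intro!: hb_eqI simp: hb_apply_zero hb_apply_add hb_apply_scaleC hb_apply_scaleR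
      hb_apply_uminus hb_apply_minus algebra_simps)

end

text \<open>The topology of uniform convergence on the sets \<open>A\<close> with \<open>ball_bounded A\<close>;
  these are directed, and \<open>tendsto_hb_iff\<close> below describes its convergent filters.\<close>

definition hb_nbhd :: "'h::complex_hilbert hb \<Rightarrow> 'h set \<Rightarrow> real \<Rightarrow> 'h hb set" where
  "hb_nbhd f A e = {g. \<forall>x\<in>A. cmod (hb_apply g x - hb_apply f x) < e}"

instantiation hb :: (complex_hilbert) topological_space
begin

definition open_hb_def:
  "open (U :: 'a hb set) \<longleftrightarrow> (\<forall>f\<in>U. \<exists>A e. ball_bounded A \<and> e > 0 \<and> hb_nbhd f A e \<subseteq> U)"

instance
proof
  show "open (UNIV :: 'a hb set)"
    unfolding open_hb_def 
    by (intro ballI exI[of _ "{}"] exI[of _ 1]) (auto simp: ball_bounded_empty)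
next
  fix S T :: "'a hb set" assume ST: "open S" "open T"
  show "open (S \<inter> T)"
    unfolding open_hb_def
  proof
    fix f assume f: "f \<in> S \<inter> T"
    obtain A d where A: "ball_bounded A" "d > 0" "hb_nbhd f A d \<subseteq> S"
      using ST f unfolding open_hb_def by blast
    obtain B e where B: "ball_bounded B" "e > 0" "hb_nbhd f B e \<subseteq> T"
      using ST f unfolding open_hb_def by blast
    have "hb_nbhd f (A \<union> B) (min d e) \<subseteq> hb_nbhd f A d \<inter> hb_nbhd f B e"
      by (auto simp: hb_nbhd_def)
    with A B show "\<exists>A e. ball_bounded A \<and> e > 0 \<and> hb_nbhd f A e \<subseteq> S \<inter> T"
      by (intro exI[of _ "A \<union> B"] exI[of _ "min d e"]) (auto simp: ball_bounded_Un)
  qed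
next
  fix K :: "'a hb set set" assume "\<forall>S\<in>K. open S"
  then show "open (\<Union>K)"
    unfolding open_hb_def by (meson Union_iff Union_upper subset_trans)
qed

end

lemma eventually_nhds_hb:
  "eventually P (nhds f) \<longleftrightarrow>
     (\<exists>A e. ball_bounded A \<and> e > 0 \<and> (\<forall>g\<in>hb_nbhd f A e. P g))"
proof
  assume "eventually P (nhds f)"
  then obtain S where "open S" "f \<in> S" "\<forall>g\<in>S. P g"
    by (auto simp: eventually_nhds)
  then show "\<exists>A e. ball_bounded A \<and> e > 0 \<and> (\<forall>g\<in>hb_nbhd f A e. P g)"
    unfolding open_hb_def by blast
next
  assume R: "\<exists>A e. ball_bounded A \<and> e > 0 \<and> (\<forall>g\<in>hb_nbhd f A e. P g)"
  define S where "S = {h. \<exists>A e. ball_bounded A \<and> e > 0 \<and> (\<forall>g\<in>hb_nbhd h A e. P g)}"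
  have "open S"
    unfolding open_hb_def
  proof
    fix h assume "h \<in> S"
    then obtain A e where A: "ball_bounded A" "e > 0" "\<forall>g\<in>hb_nbhd h A e. P g"
      unfolding S_def by blast
    have "k \<in> S" if k: "k \<in> hb_nbhd h A (e/2)" for k
    proof -
      have "hb_nbhd k A (e/2) \<subseteq> hb_nbhd h A e"
      proof
        fix g assume g: "g \<in> hb_nbhd k A (e/2)"
        have "cmod (hb_apply g x - hb_apply h x) < e" if "x \<in> A" for x
        proof -
          have "cmod (hb_apply g x - hb_apply k x) < e/2" "cmod (hb_apply k x - hb_apply h x) < e/2"
            using g k that by (auto simp: hb_nbhd_def)
          then show ?thesis
            using norm_triangle_ineq[of "hb_apply g x - hb_apply k x" "hb_apply k x - hb_apply h x"]
            by simp
        qed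
        then show "g \<in> hb_nbhd h A e" by (simp add: hb_nbhd_def)
      qed
      then show ?thesis
        using A unfolding S_def by (auto intro!: exI[of _ A] exI[of _ "e/2"])
    qed
    with A show "\<exists>A e. ball_bounded A \<and> e > 0 \<and> hb_nbhd h A e \<subseteq> S"
      by (intro exI[of _ A] exI[of _ "e/2"]) auto
  qed
  moreover have "f \<in> S" using R by (simp add: S_def)
  moreover have "\<forall>g\<in>S. P g" by (force simp: S_def hb_nbhd_def)
  ultimately show "eventually P (nhds f)" by (auto simp: eventually_nhds)
qed

lemma tendsto_hb_iff:
  "(F \<longlongrightarrow> f) G \<longleftrightarrow>
     (\<forall>A. ball_bounded A \<longrightarrow> uniform_limit A (\<lambda>i. hb_apply (F i)) (hb_apply f) G)"
proof
  assume L: "(F \<longlongrightarrow> f) G"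
  show "\<forall>A. ball_bounded A \<longrightarrow> uniform_limit A (\<lambda>i. hb_apply (F i)) (hb_apply f) G"
  proof (intro allI impI uniform_limitI)
    fix A :: "'b set" and e :: real assume "ball_bounded A" "e > 0"
    then have "eventually (\<lambda>g. g \<in> hb_nbhd f A e) (nhds f)"
      by (auto simp: eventually_nhds_hb)
    then have "eventually (\<lambda>i. F i \<in> hb_nbhd f A e) G"
      using L unfolding filterlim_iff by blast
    then show "\<forall>\<^sub>F i in G. \<forall>x\<in>A. dist (hb_apply (F i) x) (hb_apply f x) < e"
      by (simp add: hb_nbhd_def dist_norm)
  qed
next
  assume R: "\<forall>A. ball_bounded A \<longrightarrow> uniform_limit A (\<lambda>i. hb_apply (F i)) (hb_apply f) G"
  show "(F \<longlongrightarrow> f) G"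
    unfolding filterlim_iff
  proof (intro allI impI)
    fix P assume "eventually P (nhds f)"
    then obtain A e where A: "ball_bounded A" "e > 0" "\<forall>g\<in>hb_nbhd f A e. P g"
      by (auto simp: eventually_nhds_hb)
    then have "\<forall>\<^sub>F i in G. \<forall>x\<in>A. dist (hb_apply (F i) x) (hb_apply f x) < e"
      using R by (auto simp: uniform_limit_iff)
    then show "\<forall>\<^sub>F i in G. P (F i)"
      by eventually_elim (use A in \<open>auto simp: hb_nbhd_def dist_norm\<close>)
  qed
qed

instance hb :: (complex_hilbert) locally_convex_t2
proof
  fix f g :: "'a hb" assume "f \<noteq> g"
  then obtain x where x: "hb_apply f x \<noteq> hb_apply g x" by (metis hb_eqI)
  then have "x \<in> ball 0 1"
    using hb_functionsD(3)[OF hb_apply, of x f] hb_functionsD(3)[OF hb_apply, of x g] by fastforce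
  then have bb: "ball_bounded {x}" by (rule ball_bounded_singleton)
  define e where "e = dist (hb_apply f x) (hb_apply g x) / 2"
  have e: "e > 0" using x by (simp add: e_def)
  have "eventually (\<lambda>h. h \<in> hb_nbhd f {x} e) (nhds f)" "eventually (\<lambda>h. h \<in> hb_nbhd g {x} e) (nhds g)"
    using bb e by (auto simp: eventually_nhds_hb)
  then obtain U V where UV: "open U" "f \<in> U" "U \<subseteq> hb_nbhd f {x} e"
      "open V" "g \<in> V" "V \<subseteq> hb_nbhd g {x} e"
    unfolding eventually_nhds by blast
  have "hb_nbhd f {x} e \<inter> hb_nbhd g {x} e = {}"
  proof (rule ccontr)
    assume "hb_nbhd f {x} e \<inter> hb_nbhd g {x} e \<noteq> {}"
    then obtain h where "dist (hb_apply h x) (hb_apply f x) < e" "dist (hb_apply h x) (hb_apply g x) < e"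
      by (auto simp: hb_nbhd_def dist_norm)
    then show False
      using dist_triangle2[of "hb_apply f x" "hb_apply g x" "hb_apply h x"]
      by (simp add: e_def dist_commute)
  qed
  with UV show "\<exists>U V. open U \<and> open V \<and> f \<in> U \<and> g \<in> V \<and> U \<inter> V = {}" by blast
next
  fix a b :: "'a hb"
  have "((\<lambda>p::'a hb \<times> 'a hb. fst p) \<longlongrightarrow> a) (nhds a \<times>\<^sub>F nhds b)"
    "((\<lambda>p::'a hb \<times> 'a hb. snd p) \<longlongrightarrow> b) (nhds a \<times>\<^sub>F nhds b)"
    by (simp_all add: filterlim_fst filterlim_snd)
  then show "((\<lambda>p. fst p + snd p) \<longlongrightarrow> a + b) (nhds a \<times>\<^sub>F nhds b)"
    unfolding tendsto_hb_iff by (simp add: hb_apply_add[abs_def] uniform_limit_add)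
next
  fix a :: "'a hb"
  have "((\<lambda>p::'a hb. p) \<longlongrightarrow> a) (nhds a)" by (simp add: filterlim_ident)
  then show "(uminus \<longlongrightarrow> - a) (nhds a)"
    unfolding tendsto_hb_iff by (simp add: hb_apply_uminus[abs_def] uniform_limit_uminus)
next
  fix c :: complex and f :: "'a hb"
  have 1: "((\<lambda>p::complex \<times> 'a hb. fst p) \<longlongrightarrow> c) (nhds c \<times>\<^sub>F nhds f)"
    and 2: "((\<lambda>p::complex \<times> 'a hb. snd p) \<longlongrightarrow> f) (nhds c \<times>\<^sub>F nhds f)"
    by (simp_all add: filterlim_fst filterlim_snd)
  show "((\<lambda>p. fst p *\<^sub>C snd p) \<longlongrightarrow> c *\<^sub>C f) (nhds c \<times>\<^sub>F nhds f)"
    unfolding tendsto_hb_iff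
  proof (intro allI impI)
    fix A :: "'a set" assume A: "ball_bounded A"
    have "uniform_limit A (\<lambda>(p::complex \<times> 'a hb) x. fst p) (\<lambda>_. c) (nhds c \<times>\<^sub>F nhds f)"
      using 1 by (auto simp: uniform_limit_iff tendsto_iff elim!: eventually_mono)
    moreover have "uniform_limit A (\<lambda>p. hb_apply (snd p)) (hb_apply f) (nhds c \<times>\<^sub>F nhds f)"
      using 2 A by (simp add: tendsto_hb_iff)
    moreover have "bounded ((\<lambda>_. c) ` A)" by (simp add: image_constant_conv)
    moreover have "bounded (hb_apply f ` A)"
      using hb_functionsD(2)[OF hb_apply A] .
    ultimately have "uniform_limit A (\<lambda>p x. fst p * hb_apply (snd p) x) (\<lambda>x. c * hb_apply f x)
        (nhds c \<times>\<^sub>F nhds f)"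
      using bounded_bilinear.bounded_uniform_limit[OF bounded_bilinear_mult,
        where X = A and f = "\<lambda>p x. fst p" and l = "\<lambda>_. c" and g = "\<lambda>p. hb_apply (snd p)"
          and m = "hb_apply f"]
      by blast
    then show "uniform_limit A (\<lambda>p. hb_apply (fst p *\<^sub>C snd p)) (hb_apply (c *\<^sub>C f))
        (nhds c \<times>\<^sub>F nhds f)"
      by (simp add: hb_apply_scaleC[abs_def])
  qed
next
  fix U :: "'a hb set" assume "open U" "0 \<in> U"
  then obtain A e where A: "ball_bounded A" "e > 0" "hb_nbhd 0 A e \<subseteq> U"
    unfolding open_hb_def by blast
  have "convex (hb_nbhd 0 A e)"
  proof (rule convexI)
    fix f g :: "'a hb" and u v :: real
    assume fg: "f \<in> hb_nbhd 0 A e" "g \<in> hb_nbhd 0 A e" and uv: "0 \<le> u" "0 \<le> v" "u + v = 1"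
    show "u *\<^sub>R f + v *\<^sub>R g \<in> hb_nbhd 0 A e"
      unfolding hb_nbhd_def
    proof (clarsimp simp: hb_apply_zero hb_apply_add hb_apply_scaleR)
      fix x assume "x \<in> A"
      then have "hb_apply f x \<in> ball 0 e" "hb_apply g x \<in> ball 0 e"
        using fg by (auto simp: hb_nbhd_def hb_apply_zero)
      then have "u *\<^sub>R hb_apply f x + v *\<^sub>R hb_apply g x \<in> ball 0 e"
        using uv by (intro convexD[OF convex_ball]) auto
      then show "cmod (of_real u * hb_apply f x + of_real v * hb_apply g x) < e"
        by (simp add: scaleR_conv_of_real)
    qed
  qed
  then have cvx: "\<forall>x\<in>hb_nbhd 0 A e. \<forall>y\<in>hb_nbhd 0 A e. \<forall>u\<ge>0. \<forall>v\<ge>0.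
      u + v = 1 \<longrightarrow> u *\<^sub>R x + v *\<^sub>R y \<in> hb_nbhd 0 A e"
    by (simp only: convex_def)
  obtain W where W: "open W" "0 \<in> W" "W \<subseteq> hb_nbhd 0 A e"
  proof -
    have "eventually (\<lambda>h. h \<in> hb_nbhd 0 A e) (nhds 0)"
      using A by (auto simp: eventually_nhds_hb)
    then show ?thesis using that by (auto simp: eventually_nhds)
  qed
  show "\<exists>V W. open W \<and> 0 \<in> W \<and> W \<subseteq> V \<and> V \<subseteq> U \<and>
      (\<forall>x\<in>V. \<forall>y\<in>V. \<forall>u\<ge>0. \<forall>v\<ge>0. u + v = 1 \<longrightarrow> u *\<^sub>R x + v *\<^sub>R y \<in> V)"
    by (rule exI[of _ "hb_nbhd 0 A e"], rule exI[of _ W], intro conjI; fact W A cvx)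
qed


section \<open>Composition operators\<close>

text \<open>The symbol \<open>\<psi>\<close> is only relevant on the unit ball. The definition is meaningful when
  composition with \<open>\<psi>\<close> preserves the space; \<open>hb_apply_comp_op\<close> gives a sufficient condition.\<close>

definition comp_op :: "('h::complex_hilbert \<Rightarrow> 'h) \<Rightarrow> 'h hb \<Rightarrow> 'h hb" where
  "comp_op \<psi> f = Abs_hb (\<lambda>x. if x \<in> ball 0 1 then hb_apply f (\<psi> x) else 0)"

lemma hb_apply_comp_op:
  assumes hol: "frechet_holomorphic_on \<psi> (ball 0 1)"
    and maps: "\<And>x. x \<in> ball 0 1 \<Longrightarrow> \<psi> x \<in> ball 0 1"
    and bdd: "\<And>A. ball_bounded A \<Longrightarrow> ball_bounded (\<psi> ` A)"
    and x: "x \<in> ball 0 1"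
  shows "hb_apply (comp_op \<psi> f) x = hb_apply f (\<psi> x)"
proof -
  let ?g = "\<lambda>x. if x \<in> ball 0 1 then hb_apply f (\<psi> x) else 0"
  have f: "frechet_holomorphic_on (hb_apply f) (ball 0 1)"
      "\<And>A. ball_bounded A \<Longrightarrow> bounded (hb_apply f ` A)"
    using hb_apply[of f] by (auto simp: hb_functions_def)
  have "\<exists>D. complex_linear D \<and> (?g has_derivative D) (at y)" if y: "y \<in> ball 0 1" for y
  proof -
    obtain D where D: "complex_linear D" "(\<psi> has_derivative D) (at y)"
      using hol y unfolding frechet_holomorphic_on_def by blast
    obtain E where E: "complex_linear E" "(hb_apply f has_derivative E) (at (\<psi> y))"
      using f(1) maps[OF y] unfolding frechet_holomorphic_on_def by blast
    have "((\<lambda>x. hb_apply f (\<psi> x)) has_derivative (\<lambda>v. E (D v))) (at y)"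
      using has_derivative_compose[OF D(2) E(2)] .
    then have "(?g has_derivative (\<lambda>v. E (D v))) (at y)"
      by (rule has_derivative_transform_within_open[OF _ open_ball y]) auto
    moreover have "complex_linear (\<lambda>v. E (D v))"
      using D E by (simp add: complex_linear_def)
    ultimately show ?thesis by blast
  qed
  moreover have "bounded (?g ` A)" if A: "ball_bounded A" for A
  proof -
    have "?g ` A = hb_apply f ` \<psi> ` A"
      using ball_bounded_subset[OF A] by (auto simp: image_image simp del: mem_ball mem_ball_0 intro!: image_cong)
    then show ?thesis using f(2)[OF bdd[OF A]] by simp
  qed
  ultimately have "?g \<in> hb_functions"
    by (auto simp: hb_functions_def frechet_holomorphic_on_def simp del: mem_ball mem_ball_0)
  then show ?thesis using x by (simp add: comp_op_def Abs_hb_inverse del: mem_ball mem_ball_0)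
qed

end

theory Submission
  imports Defs "HOL-Complex_Analysis.Cauchy_Integral_Formula"
begin

text \<open>The proof follows Earle and Hamilton. Call the infinitesimal Caratheodory length of a tangent
  vector \<open>w\<close> at \<open>x\<close> the supremum of \<open>|g'(x) w|\<close> over all holomorphic \<open>g\<close> from the ball to the closed
  unit disc. Holomorphic self-maps of the ball cannot increase it, by the chain rule. As the
  image of \<open>\<phi>\<close> stays away from the unit sphere, there is room to stretch \<open>\<phi>\<close> about the point
  \<open>\<phi> x\<close> by a factor \<open>1 + t > 1\<close> and still have a self-map of the ball. The stretched map does not
  increase the length, hence \<open>\<phi>\<close> itself shrinks it by the factor \<open>q = 1 / (1 + t)\<close>
  (\<open>caratheodory_length_le_contract\<close>), and \<open>\<phi>\<^sup>n\<close> shrinks it by \<open>q\<^sup>n\<close>.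

  On the smaller ball of radius \<open>r\<close> the Caratheodory length is at most a constant times the norm, by
  Cauchy's estimate. The mean value inequality on this convex set then gives
  \<open>|g (\<phi>\<^sup>n x) - g (\<phi>\<^sup>n y)| \<le> K q\<^sup>n\<close> with the same \<open>K\<close> and \<open>q\<close> for all \<open>x\<close>, \<open>y\<close> in the unit ball and all
  such \<open>g\<close> (\<open>disc_functions_geometric_contraction\<close>). Everything else is read off from this estimate.

  Taking for \<open>g\<close> the functional given by the inner product with a unit vector, it bounds
  \<open>\<parallel>\<phi>\<^sup>n x - \<phi>\<^sup>n y\<parallel>\<close>, so the orbit of the origin is Cauchy and its limit is the only fixed point \<open>a\<close>
  (\<open>earle_hamilton\<close>). Taking \<open>g = (f \<circ> \<phi>) / M\<close>, where \<open>f\<close> is in \<open>H\<^sub>b\<close> and bounded by \<open>M\<close> on the ball of radius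
  \<open>r\<close>, it bounds \<open>|f (\<phi>\<^sup>n x) - f a|\<close> by a multiple of \<open>M q\<^sup>n\<close> (\<open>hb_iterates_geometric\<close>). A bounded set of
  functions in \<open>H\<^sub>b\<close> has a common \<open>M\<close>, so the powers of the composition operator converge geometrically,
  uniformly on bounded sets. Their Cesaro means then converge at the rate \<open>1 / n\<close>, since the
  errors of the powers have a finite sum.\<close>


section \<open>Frechet holomorphic maps\<close>

lemma complex_linear_scaleR:
  assumes "complex_linear T"
  shows "T (r *\<^sub>R x) = r *\<^sub>R T x"
  using assms by (simp add: complex_linear_def scaleR_scaleC)

lemma scaleC_scaleR_commute: "c *\<^sub>C r *\<^sub>R x = r *\<^sub>R c *\<^sub>C (x::'a::complex_vector)"
  by (simp add: scaleR_scaleC scaleC_scaleC mult.commute)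

lemma scaleC_zero_right [simp]: "c *\<^sub>C (0::'a::complex_vector) = 0"
  using scaleC_add_right[of c 0 "0::'a"] by simp

lemma bounded_linear_scaleC_left: "bounded_linear (\<lambda>c. c *\<^sub>C (v::'a::complex_normed_vector))"
  by (rule bounded_linear_intro[of _ "norm v"])
    (simp_all add: scaleC_add_left norm_scaleC scaleR_scaleC[where 'a = 'a] scaleC_scaleC
      scaleR_conv_of_real)

lemma frechet_holomorphic_on_subset:
  "frechet_holomorphic_on f U \<Longrightarrow> V \<subseteq> U \<Longrightarrow> frechet_holomorphic_on f V"
  unfolding frechet_holomorphic_on_def by blast

lemma frechet_holomorphic_on_compose:
  assumes "frechet_holomorphic_on f U" "frechet_holomorphic_on g V" "f ` U \<subseteq> V"
  shows "frechet_holomorphic_on (\<lambda>x. g (f x)) U"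
  unfolding frechet_holomorphic_on_def
proof
  fix x assume x: "x \<in> U"
  obtain D where D: "complex_linear D" "(f has_derivative D) (at x)"
    using assms(1) x unfolding frechet_holomorphic_on_def by blast
  obtain E where E: "complex_linear E" "(g has_derivative E) (at (f x))"
    using assms x unfolding frechet_holomorphic_on_def by blast
  have "complex_linear (\<lambda>v. E (D v))"
    using D(1) E(1) by (simp add: complex_linear_def)
  then show "\<exists>D. complex_linear D \<and> ((\<lambda>x. g (f x)) has_derivative D) (at x)"
    using has_derivative_compose[OF D(2) E(2)] by blast
qed

lemma frechet_holomorphic_on_const:
  "frechet_holomorphic_on (\<lambda>_. c) U"
  by (auto simp: frechet_holomorphic_on_def complex_linear_def intro!: exI[of _ "\<lambda>_. 0"])

lemma frechet_holomorphic_on_id: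
  "frechet_holomorphic_on (\<lambda>x. x) U"
  by (auto simp: frechet_holomorphic_on_def complex_linear_def intro!: exI[of _ "\<lambda>x. x"])

lemma frechet_holomorphic_on_divide:
  fixes f :: "'a::complex_normed_vector \<Rightarrow> complex"
  assumes "frechet_holomorphic_on f U"
  shows "frechet_holomorphic_on (\<lambda>x. f x / c) U"
  unfolding frechet_holomorphic_on_def
proof
  fix x assume "x \<in> U"
  then obtain D where D: "complex_linear D" "(f has_derivative D) (at x)"
    using assms unfolding frechet_holomorphic_on_def by blast
  have "complex_linear (\<lambda>v. D v / c)"
    using D(1) by (simp add: complex_linear_def scaleC_complex_def add_divide_distrib)
  moreover have "((\<lambda>x. f x / c) has_derivative (\<lambda>v. D v / c)) (at x)"
    using has_derivative_mult_left[OF D(2), of "inverse c"] by (simp add: divide_inverse)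
  ultimately show "\<exists>D. complex_linear D \<and> ((\<lambda>x. f x / c) has_derivative D) (at x)"
    by blast
qed

text \<open>Along a complex line, a Frechet holomorphic function is an ordinary holomorphic function
  of one variable; the factor 2 pays for shrinking to a closed disc, on which
  Cauchy's inequality applies.\<close>

lemma cauchy_estimate:
  fixes g :: "'a::complex_normed_vector \<Rightarrow> complex"
  assumes g: "frechet_holomorphic_on g (ball z \<rho>)" and \<rho>: "\<rho> > 0"
    and bd: "\<And>w. w \<in> ball z \<rho> \<Longrightarrow> cmod (g w) \<le> M"
    and D: "(g has_derivative D) (at z)"
  shows "cmod (D v) \<le> 2 * M * norm v / \<rho>"
proof (cases "v = 0")
  case True
  then show ?thesis using linear_0[OF has_derivative_linear[OF D]] by simp
next
  case False
  define R where "R = \<rho> / (2 * norm v)"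
  have R: "R > 0" using \<rho> False by (simp add: R_def)
  let ?h = "\<lambda>c. g (z + c *\<^sub>C v)"
  have line: "((\<lambda>c. z + c *\<^sub>C v) has_derivative (\<lambda>c. c *\<^sub>C v)) (at c)" for c
    using has_derivative_add[OF has_derivative_const[of z]
        bounded_linear_imp_has_derivative[OF bounded_linear_scaleC_left[of v]]]
    by simp
  have mem: "z + c *\<^sub>C v \<in> ball z \<rho>" if "cmod c \<le> R" for c
  proof -
    have "norm (c *\<^sub>C v) \<le> R * norm v"
      using that by (simp add: norm_scaleC mult_right_mono)
    also have "\<dots> = \<rho> / 2" using False by (simp add: R_def)
    also have "\<dots> < \<rho>" using \<rho> by simp
    finally show ?thesis by (simp add: dist_norm)
  qed
  have fd: "\<exists>E. (g has_derivative E) (at (z + c *\<^sub>C v)) \<and> (?h has_field_derivative E v) (at c)"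
    if c: "cmod c \<le> R" for c
  proof -
    obtain E where E: "complex_linear E" "(g has_derivative E) (at (z + c *\<^sub>C v))"
      using g mem[OF c] unfolding frechet_holomorphic_on_def by blast
    have "(?h has_derivative (\<lambda>c. E (c *\<^sub>C v))) (at c)"
      using has_derivative_compose[OF line E(2)] .
    moreover have "(\<lambda>c. E (c *\<^sub>C v)) = (*) (E v)"
      using E(1) by (auto simp: complex_linear_def scaleC_complex_def mult.commute)
    ultimately show ?thesis using E(2) unfolding has_field_derivative_def by metis
  qed
  have "cmod ((deriv ^^ 1) ?h 0) \<le> fact 1 * M / R ^ 1"
  proof (rule Cauchy_inequality)
    show "?h holomorphic_on ball 0 R"
      unfolding holomorphic_on_def by (metis fd less_imp_le mem_ball_0 field_differentiable_def
          field_differentiable_at_within)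
    show "continuous_on (cball 0 R) ?h"
      by (rule continuous_at_imp_continuous_on)
        (metis fd mem_cball_0 DERIV_isCont)
    show "R > 0" by (fact R)
    show "cmod (?h c) \<le> M" if "cmod (0 - c) = R" for c
      using bd[OF mem] that by simp
  qed
  moreover have "deriv ?h 0 = D v"
  proof -
    obtain E where E: "(g has_derivative E) (at (z + 0 *\<^sub>C v))" "(?h has_field_derivative E v) (at 0)"
      using fd[of 0] R by auto
    have "(0::complex) *\<^sub>C v = 0" using scaleR_scaleC[of 0 v] by simp
    then have "E = D" using has_derivative_unique[OF D] E(1) by simp
    then show ?thesis using DERIV_imp_deriv[OF E(2)] by simp
  qed
  ultimately show ?thesis by (simp add: R_def field_simps)
qed


section \<open>Contraction of the infinitesimal Caratheodory metric\<close>

definition disc_functions :: "('h::complex_normed_vector \<Rightarrow> complex) set" where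
  "disc_functions = {g. frechet_holomorphic_on g (ball 0 1) \<and> (\<forall>x\<in>ball 0 1. cmod (g x) \<le> 1)}"

lemma disc_functions_compose:
  assumes "g \<in> disc_functions" "frechet_holomorphic_on \<psi> (ball 0 1)" "\<psi> ` ball 0 1 \<subseteq> ball 0 1"
  shows "(\<lambda>x. g (\<psi> x)) \<in> disc_functions"
  using assms frechet_holomorphic_on_compose[of \<psi> "ball 0 1" g "ball 0 1"]
  unfolding disc_functions_def by blast

text \<open>An upper bound for the supremum defining the Caratheodory length. Working with bounds
  instead of the supremum avoids having to show that the latter is finite.\<close>

definition caratheodory_length_le :: "'h::complex_normed_vector \<Rightarrow> 'h \<Rightarrow> real \<Rightarrow> bool" where
  "caratheodory_length_le x w M \<longleftrightarrow>
     (\<forall>g\<in>disc_functions. \<forall>D. (g has_derivative D) (at x) \<longrightarrow> cmod (D w) \<le> M)"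

lemma caratheodory_length_le_norm:
  assumes x: "x \<in> ball 0 1"
  shows "caratheodory_length_le x w (2 * norm w / (1 - norm x))"
  unfolding caratheodory_length_le_def
proof (intro ballI allI impI)
  fix g D assume g: "g \<in> disc_functions" and D: "(g has_derivative D) (at x)"
  have sub: "ball x (1 - norm x) \<subseteq> ball 0 1"
  proof
    fix y assume "y \<in> ball x (1 - norm x)"
    then show "y \<in> ball 0 1"
      using norm_triangle_ineq2[of y x] by (simp add: dist_norm norm_minus_commute)
  qed
  have "cmod (D w) \<le> 2 * 1 * norm w / (1 - norm x)"
    using g x sub
    by (intro cauchy_estimate[OF frechet_holomorphic_on_subset[OF _ sub] _ _ D])
      (auto simp: disc_functions_def simp del: mem_ball)
  then show "cmod (D w) \<le> 2 * norm w / (1 - norm x)" by simp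
qed

text \<open>Stretching \<open>\<phi>\<close> about \<open>\<phi> x\<close> gives \<open>\<psi> z = \<phi> z + t (\<phi> z - \<phi> x)\<close>, which takes the same value as
  \<open>\<phi>\<close> at \<open>x\<close> but has \<open>1 + t\<close> times its derivative there. If \<open>\<psi>\<close> maps the ball to itself,
  then \<open>g \<circ> \<psi>\<close> competes in the supremum at \<open>x\<close>, and the factor \<open>1 + t\<close> is gained.\<close>

lemma caratheodory_length_le_contract:
  fixes \<phi> :: "'h::complex_normed_vector \<Rightarrow> 'h"
  assumes hol: "frechet_holomorphic_on \<phi> (ball 0 1)"
    and r: "0 < r" "r < 1" and maps: "\<phi> ` ball 0 1 \<subseteq> ball 0 r"
    and x: "x \<in> ball 0 1" and A: "(\<phi> has_derivative A) (at x)"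
    and M: "caratheodory_length_le x w M"
  shows "caratheodory_length_le (\<phi> x) (A w) (M / (1 + (1 - r) / 2))"
  unfolding caratheodory_length_le_def
proof (intro ballI allI impI)
  fix g D assume g: "g \<in> disc_functions" and D: "(g has_derivative D) (at (\<phi> x))"
  \<comment> \<open>\<open>\<psi>\<close> is a self-map of the ball as soon as \<open>r + 2 r t \<le> 1\<close>; for this \<open>t\<close> the left-hand side
    is \<open>1 - (1 - r)\<^sup>2\<close>.\<close>
  define t where "t = (1 - r) / 2"
  have t: "t > 0" using r by (simp add: t_def)
  define \<psi> where "\<psi> = (\<lambda>z. (1 + t) *\<^sub>R \<phi> z - t *\<^sub>R \<phi> x)"
  have der: "(\<psi> has_derivative (\<lambda>v. (1 + t) *\<^sub>R E v)) (at z)"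
    if "(\<phi> has_derivative E) (at z)" for z E
    unfolding \<psi>_def using that by (auto intro!: derivative_eq_intros)
  have hol\<psi>: "frechet_holomorphic_on \<psi> (ball 0 1)"
    unfolding frechet_holomorphic_on_def
  proof
    fix z :: 'h assume "z \<in> ball 0 1"
    then obtain E where E: "complex_linear E" "(\<phi> has_derivative E) (at z)"
      using hol unfolding frechet_holomorphic_on_def by blast
    have "complex_linear (\<lambda>v. (1 + t) *\<^sub>R E v)"
      using E(1) by (simp add: complex_linear_def scaleR_add_right scaleC_scaleR_commute)
    then show "\<exists>D. complex_linear D \<and> (\<psi> has_derivative D) (at z)"
      using der[OF E(2)] by blast
  qed
  have maps\<psi>: "\<psi> ` ball 0 1 \<subseteq> ball 0 1"
  proof safe
    fix z :: 'h assume z: "z \<in> ball 0 1"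
    have n: "norm (\<phi> z) < r" "norm (\<phi> x) < r" using maps z x by (simp_all add: image_subset_iff)
    have "norm (\<psi> z) \<le> (1 + t) * norm (\<phi> z) + t * norm (\<phi> x)"
      unfolding \<psi>_def using t norm_triangle_ineq4[of "(1 + t) *\<^sub>R \<phi> z" "t *\<^sub>R \<phi> x"] by simp
    also have "\<dots> \<le> (1 + t) * r + t * r"
      using n t by (intro add_mono mult_left_mono) auto
    also have "\<dots> = 1 - (1 - r)\<^sup>2" by (simp add: t_def power2_eq_square field_simps)
    also have "\<dots> < 1" using r by simp
    finally show "\<psi> z \<in> ball 0 1" by simp
  qed
  have \<psi>x: "\<psi> x = \<phi> x" by (simp add: \<psi>_def scaleR_add_left)
  have "((\<lambda>z. g (\<psi> z)) has_derivative (\<lambda>v. D ((1 + t) *\<^sub>R A v))) (at x)"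
    using has_derivative_compose[OF der[OF A]] D \<psi>x by simp
  then have "cmod (D ((1 + t) *\<^sub>R A w)) \<le> M"
    using M disc_functions_compose[OF g hol\<psi> maps\<psi>] unfolding caratheodory_length_le_def by blast
  then have "(1 + t) * cmod (D (A w)) \<le> M"
    using t linear_scale[OF has_derivative_linear[OF D]] by simp
  then show "cmod (D (A w)) \<le> M / (1 + (1 - r) / 2)"
    using t unfolding t_def[symmetric] by (simp add: field_simps)
qed

lemma funpow_maps:
  assumes "\<phi> ` U \<subseteq> U" "x \<in> U"
  shows "(\<phi> ^^ n) x \<in> U"
  using assms by (induction n) auto

lemma frechet_holomorphic_on_funpow:
  assumes "frechet_holomorphic_on \<phi> U" "\<phi> ` U \<subseteq> U"
  shows "frechet_holomorphic_on (\<phi> ^^ n) U"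
proof (induction n)
  case 0
  then show ?case using frechet_holomorphic_on_id[of U] by (simp add: id_def)
next
  case (Suc n)
  have "(\<phi> ^^ n) ` U \<subseteq> U" using funpow_maps[OF assms(2)] by blast
  from frechet_holomorphic_on_compose[OF Suc assms(1) this] show ?case by (simp add: o_def)
qed

text \<open>In the induction step a disc function composed with \<open>\<phi>\<^sup>n\<^sup>+\<^sup>1\<close> is differentiated at \<open>x\<close> in the
  direction \<open>w\<close>; this is the same as differentiating its composition with \<open>\<phi>\<close> at \<open>\<phi>\<^sup>n x\<close> in the direction
  \<open>(\<phi>\<^sup>n)'(x) w\<close>, so the contraction is applied there.\<close>

lemma caratheodory_length_le_funpow:
  fixes \<phi> :: "'h::complex_normed_vector \<Rightarrow> 'h"
  assumes hol: "frechet_holomorphic_on \<phi> (ball 0 1)"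
    and r: "0 < r" "r < 1" and maps: "\<phi> ` ball 0 1 \<subseteq> ball 0 r"
    and x: "x \<in> ball 0 1" and A: "((\<phi> ^^ n) has_derivative A) (at x)"
  shows "caratheodory_length_le ((\<phi> ^^ n) x) (A w)
           (2 * norm w / (1 - norm x) * (1 / (1 + (1 - r) / 2)) ^ n)"
  using A
proof (induction n arbitrary: A)
  case 0
  then have "A = (\<lambda>v. v)"
    using has_derivative_unique[OF has_derivative_ident] by (force simp: id_def)
  then show ?case using caratheodory_length_le_norm[OF x] by simp
next
  case (Suc n)
  have self: "\<phi> ` ball 0 1 \<subseteq> ball 0 1"
    using maps subset_ball[of r 1 0] r by (meson less_imp_le order_trans)
  have y: "(\<phi> ^^ n) x \<in> ball 0 1" using funpow_maps[OF self x] .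
  obtain E where E: "((\<phi> ^^ n) has_derivative E) (at x)"
    using frechet_holomorphic_on_funpow[OF hol self] x unfolding frechet_holomorphic_on_def by blast
  obtain F where F: "(\<phi> has_derivative F) (at ((\<phi> ^^ n) x))"
    using hol y unfolding frechet_holomorphic_on_def by blast
  have "((\<phi> ^^ Suc n) has_derivative (\<lambda>v. F (E v))) (at x)"
    using has_derivative_compose[OF E F] by (simp add: o_def)
  with Suc.prems have "A = (\<lambda>v. F (E v))" by (rule has_derivative_unique)
  then show ?case
    using caratheodory_length_le_contract[OF hol r maps y F Suc.IH[OF E]]
    by (simp add: field_simps)
qed

text \<open>The bound of the derivative blows up at the unit sphere, so the mean value inequality is applied
  on the ball of radius \<open>r\<close>, where \<open>1 - norm z\<close> is bounded below. One application of \<open>\<phi>\<close> brings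
  all points of the unit ball there.\<close>

lemma disc_functions_geometric_contraction:
  fixes \<phi> :: "'h::complex_normed_vector \<Rightarrow> 'h"
  assumes hol: "frechet_holomorphic_on \<phi> (ball 0 1)"
    and r: "0 < r" "r < 1" and maps: "\<phi> ` ball 0 1 \<subseteq> ball 0 r"
  obtains q K where "0 < q" "q < 1" "K \<ge> 0"
    "\<And>g n x y. g \<in> disc_functions \<Longrightarrow> x \<in> ball 0 1 \<Longrightarrow> y \<in> ball 0 1 \<Longrightarrow>
       cmod (g ((\<phi> ^^ n) x) - g ((\<phi> ^^ n) y)) \<le> K * q ^ n"
proof -
  define q where "q = 1 / (1 + (1 - r) / 2)"
  define C where "C = 2 / (1 - r)"
  have q: "0 < q" "q < 1" using r by (simp_all add: q_def divide_simps)
  have C: "C > 0" using r by (simp add: C_def)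
  have self: "\<phi> ` ball 0 1 \<subseteq> ball 0 1"
    using maps subset_ball[of r 1 0] r by (meson less_imp_le order_trans)
  have main: "cmod (g ((\<phi> ^^ n) x) - g ((\<phi> ^^ n) y)) \<le> 2 * C * q ^ n"
    if g: "g \<in> disc_functions" and xy: "x \<in> ball 0 r" "y \<in> ball 0 r" for g n x y
  proof -
    have ex: "\<exists>D. ((\<lambda>x. g ((\<phi> ^^ n) x)) has_derivative D) (at z) \<and> onorm D \<le> C * q ^ n"
      if z: "z \<in> ball 0 r" for z
    proof -
      have z1: "z \<in> ball 0 1" using z r by simp
      obtain E where E: "((\<phi> ^^ n) has_derivative E) (at z)"
        using frechet_holomorphic_on_funpow[OF hol self] z1
        unfolding frechet_holomorphic_on_def by blast
      obtain G where G: "(g has_derivative G) (at ((\<phi> ^^ n) z))"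
        using g funpow_maps[OF self z1] unfolding disc_functions_def frechet_holomorphic_on_def
        by blast
      have "onorm (\<lambda>v. G (E v)) \<le> C * q ^ n"
      proof (rule onorm_bound)
        fix v
        have "cmod (G (E v)) \<le> 2 * norm v / (1 - norm z) * q ^ n"
          using caratheodory_length_le_funpow[OF hol r maps z1 E, of v] g G
          unfolding caratheodory_length_le_def q_def by blast
        also have "\<dots> \<le> 2 * norm v / (1 - r) * q ^ n"
          using z r q by (intro mult_right_mono divide_left_mono mult_pos_pos) auto
        finally show "cmod (G (E v)) \<le> C * q ^ n * norm v" by (simp add: C_def mult_ac)
      qed (use C q in simp)
      then show ?thesis using has_derivative_compose[OF E G] by blast
    qed
    then obtain D where D: "\<And>z. z \<in> ball 0 r \<Longrightarrow>
        ((\<lambda>x. g ((\<phi> ^^ n) x)) has_derivative D z) (at z) \<and> onorm (D z) \<le> C * q ^ n"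
      by metis
    have "cmod (g ((\<phi> ^^ n) x) - g ((\<phi> ^^ n) y)) \<le> C * q ^ n * norm (x - y)"
      by (rule differentiable_bound[OF convex_ball[of 0 r], where f' = D])
        (use D xy has_derivative_at_withinI in blast)+
    also have "\<dots> \<le> C * q ^ n * 2"
      using xy r C q norm_triangle_ineq4[of x y] by (intro mult_left_mono) auto
    finally show ?thesis by (simp add: mult_ac)
  qed
  show ?thesis
    \<comment> \<open>The term \<open>2\<close> covers \<open>n = 0\<close>, where two values in the unit disc are compared; the factor
      \<open>1 / q\<close> makes up for the application of \<open>\<phi>\<close> spent on reaching the ball of radius \<open>r\<close>.\<close>
  proof (rule that[of q "2 + 2 * C / q"])
    fix g :: "'h \<Rightarrow> complex" and n and x y :: 'h
    assume g: "g \<in> disc_functions" and xy: "x \<in> ball 0 1" "y \<in> ball 0 1"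
    show "cmod (g ((\<phi> ^^ n) x) - g ((\<phi> ^^ n) y)) \<le> (2 + 2 * C / q) * q ^ n"
    proof (cases n)
      case 0
      have "cmod (g x) \<le> 1" "cmod (g y) \<le> 1"
        using g xy by (auto simp: disc_functions_def)
      then have "cmod (g x - g y) \<le> 2"
        using norm_triangle_ineq4[of "g x" "g y"] by simp
      also have "\<dots> \<le> 2 + 2 * C / q" using C q by simp
      finally show ?thesis using 0 by simp
    next
      case (Suc m)
      have "cmod (g ((\<phi> ^^ m) (\<phi> x)) - g ((\<phi> ^^ m) (\<phi> y))) \<le> 2 * C * q ^ m"
        using maps xy by (intro main[OF g]) (simp_all add: image_subset_iff)
      also have "\<dots> \<le> (2 + 2 * C / q) * q ^ n" using q C by (simp add: Suc field_simps)
      finally show ?thesis unfolding Suc funpow_Suc_right o_def .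
    qed
  qed (use q C in auto)
qed


section \<open>The fixed point and the convergence of the iterates\<close>

text \<open>The Cauchy-Schwarz inequality against a unit vector \<open>y\<close>: the component of \<open>x\<close> orthogonal to \<open>y\<close>
  has squared norm \<open>\<parallel>x\<parallel>\<^sup>2 - |\<langle>x, y\<rangle>|\<^sup>2\<close>.\<close>

lemma cinner_norm_le_of_unit:
  fixes x y :: "'h::complex_inner"
  assumes y: "norm y = 1"
  shows "cmod (cinner x y) \<le> norm x"
proof -
  define c where "c = cinner x y"
  have yx: "cinner y x = cnj c" unfolding c_def by (rule cinner_commute)
  have yy: "cinner y y = 1" using y by (simp add: cinner_self)
  have add_right: "cinner u (v + w) = cinner u v + cinner u w" for u v w :: 'h
    by (subst (1 2 3) cinner_commute) (simp add: cinner_add_left)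
  have scale_right: "cinner u (d *\<^sub>C v) = cnj d * cinner u v" for u v :: 'h and d
    by (subst (1 2) cinner_commute) (simp add: cinner_scaleC_left)
  let ?z = "x + (- c) *\<^sub>C y"
  have "complex_of_real ((norm ?z)\<^sup>2) = cinner ?z ?z" by (rule cinner_self[symmetric])
  also have "\<dots> = cinner x x - c * cnj c"
    by (simp only: cinner_add_left cinner_scaleC_left add_right scale_right yx yy
        c_def[symmetric]) (simp add: algebra_simps)
  also have "\<dots> = complex_of_real ((norm x)\<^sup>2 - (cmod c)\<^sup>2)"
    by (simp add: cinner_self complex_norm_square[symmetric] flip: of_real_power)
  finally have "(norm ?z)\<^sup>2 = (norm x)\<^sup>2 - (cmod c)\<^sup>2" using of_real_eq_iff by blast
  then have "(cmod c)\<^sup>2 \<le> (norm x)\<^sup>2" by (metis diff_ge_0_iff_ge zero_le_power2)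
  then show ?thesis unfolding c_def by (rule power2_le_imp_le) simp
qed

text \<open>Disc functions see the norm: the inner product with \<open>v / \<parallel>v\<parallel>\<close> is a disc function. This turns
  estimates that hold for all disc functions into estimates of the norm.\<close>

lemma disc_function_norming:
  fixes v :: "'h::complex_inner"
  obtains g where "g \<in> disc_functions" "\<And>x y. g x - g y = g (x - y)" "cmod (g v) = norm v"
proof (cases "v = 0")
  case True
  then show ?thesis
    by (intro that[of "\<lambda>_. 0"]) (auto simp: disc_functions_def frechet_holomorphic_on_const)
next
  case False
  define e where "e = (1 / norm v) *\<^sub>R v"
  have e: "norm e = 1" using False by (simp add: e_def)
  have ve: "v = complex_of_real (norm v) *\<^sub>C e"
    using False by (simp add: e_def scaleR_scaleC[symmetric])
  have lin: "complex_linear (\<lambda>x. cinner x e)"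
    by (simp add: complex_linear_def cinner_add_left cinner_scaleC_left scaleC_complex_def)
  have bl: "bounded_linear (\<lambda>x. cinner x e)"
    by (rule bounded_linear_intro[of _ 1])
      (simp_all add: cinner_add_left cinner_norm_le_of_unit[OF e] complex_linear_scaleR[OF lin])
  show ?thesis
  proof (rule that[of "\<lambda>x. cinner x e"])
    show "(\<lambda>x. cinner x e) \<in> disc_functions"
      unfolding disc_functions_def frechet_holomorphic_on_def
    proof (intro CollectI conjI ballI)
      show "\<exists>D. complex_linear D \<and> ((\<lambda>x. cinner x e) has_derivative D) (at x)" for x
        using lin bounded_linear_imp_has_derivative[OF bl] by blast
      show "cmod (cinner x e) \<le> 1" if "x \<in> ball 0 1" for x
        using cinner_norm_le_of_unit[OF e, of x] that by simp
    qed
    show "cinner x e - cinner y e = cinner (x - y) e" for x y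
      using linear_diff[OF bounded_linear.linear[OF bl]] by simp
    have "cinner v e = complex_of_real (norm v) * cinner e e"
      by (subst ve) (simp only: cinner_scaleC_left)
    then show "cmod (cinner v e) = norm v" using e by (simp add: cinner_self)
  qed
qed

text \<open>The geometric estimate makes the orbit of \<open>0\<close> a Cauchy sequence. Its limit lies in the
  closed ball of radius \<open>r\<close>, so it cannot escape to the unit sphere, and it is fixed since \<open>\<phi>\<close> is
  continuous there. The distance of two fixed points is at most \<open>K q\<^sup>n\<close> for every \<open>n\<close>.\<close>

lemma earle_hamilton:
  fixes \<phi> :: "'h::complex_hilbert \<Rightarrow> 'h"
  assumes hol: "frechet_holomorphic_on \<phi> (ball 0 1)"
    and r: "0 < r" "r < 1" and maps: "\<phi> ` ball 0 1 \<subseteq> ball 0 r"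
  shows "\<exists>!a. a \<in> ball 0 1 \<and> \<phi> a = a"
proof -
  obtain q K where q: "0 < q" "q < 1" and K: "K \<ge> 0"
    and contr: "\<And>g n x y. g \<in> disc_functions \<Longrightarrow> x \<in> ball 0 1 \<Longrightarrow> y \<in> ball 0 1 \<Longrightarrow>
       cmod (g ((\<phi> ^^ n) x) - g ((\<phi> ^^ n) y)) \<le> K * q ^ n"
    using disc_functions_geometric_contraction[OF assms] by blast
  have self: "\<phi> ` ball 0 1 \<subseteq> ball 0 1"
    using maps subset_ball[of r 1 0] r by (meson less_imp_le order_trans)
  have lim0: "(\<lambda>n. K * q ^ n) \<longlonglongrightarrow> 0"
    using q by (intro tendsto_mult_right_zero LIMSEQ_realpow_zero) auto
  have dist: "norm ((\<phi> ^^ n) x - (\<phi> ^^ n) y) \<le> K * q ^ n"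
    if "x \<in> ball 0 1" "y \<in> ball 0 1" for n x y
  proof -
    obtain g where "g \<in> disc_functions" "\<And>x y. g x - g y = g (x - y)"
        "cmod (g ((\<phi> ^^ n) x - (\<phi> ^^ n) y)) = norm ((\<phi> ^^ n) x - (\<phi> ^^ n) y)"
      using disc_function_norming[of "(\<phi> ^^ n) x - (\<phi> ^^ n) y"] by blast
    then show ?thesis using contr[OF _ that, of g n] by simp
  qed
  have "Cauchy (\<lambda>n. (\<phi> ^^ n) 0)"
  proof (rule metric_CauchyI)
    fix e :: real assume "e > 0"
    then obtain N where N: "K * q ^ N < e / 2"
      using order_tendstoD(2)[OF lim0, of "e / 2"] by (auto simp: eventually_sequentially)
    have near: "dist ((\<phi> ^^ n) 0) ((\<phi> ^^ N) 0) < e / 2" if "n \<ge> N" for n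
    proof -
      have "(\<phi> ^^ n) 0 = (\<phi> ^^ N) ((\<phi> ^^ (n - N)) 0)"
        using that by (metis add_diff_cancel_left' comp_apply funpow_add le_Suc_ex)
      then show ?thesis
        using dist[of "(\<phi> ^^ (n - N)) 0" 0 N] funpow_maps[OF self, of 0 "n - N"] N
        by (simp add: dist_norm)
    qed
    show "\<exists>N. \<forall>m\<ge>N. \<forall>n\<ge>N. dist ((\<phi> ^^ m) 0) ((\<phi> ^^ n) 0) < e"
      using near dist_triangle_half_l by blast
  qed
  then obtain a where a: "(\<lambda>n. (\<phi> ^^ n) 0) \<longlonglongrightarrow> a" by (auto simp: Cauchy_convergent_iff convergent_def)
  have a': "(\<lambda>n. \<phi> ((\<phi> ^^ n) 0)) \<longlonglongrightarrow> a" using LIMSEQ_Suc[OF a] by simp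
  have "a \<in> cball 0 r"
  proof (rule Lim_in_closed_set[OF closed_cball _ _ a'])
    have "(\<phi> ^^ n) 0 \<in> ball 0 1" for n using funpow_maps[OF self, of 0] by simp
    then have "\<phi> ((\<phi> ^^ n) 0) \<in> cball 0 r" for n
      using maps ball_subset_cball by (metis image_subset_iff subsetD)
    then show "\<forall>\<^sub>F n in sequentially. \<phi> ((\<phi> ^^ n) 0) \<in> cball 0 r" by simp
  qed simp
  then have a1: "a \<in> ball 0 1" using r by simp
  obtain D where "(\<phi> has_derivative D) (at a)"
    using hol a1 unfolding frechet_holomorphic_on_def by blast
  then have "(\<lambda>n. \<phi> ((\<phi> ^^ n) 0)) \<longlonglongrightarrow> \<phi> a"
    using isCont_tendsto_compose[OF has_derivative_continuous a] by blast
  then have fix_a: "\<phi> a = a" using a' LIMSEQ_unique by blast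
  have "b = a" if b: "b \<in> ball 0 1" "\<phi> b = b" for b
  proof -
    have "(\<phi> ^^ n) a = a" "(\<phi> ^^ n) b = b" for n
      using fix_a b(2) by (induction n) auto
    then have "norm (b - a) \<le> K * q ^ n" for n using dist[OF b(1) a1, of n] by simp
    then have "norm (b - a) \<le> 0" by (intro LIMSEQ_le_const[OF lim0]) auto
    then show ?thesis by simp
  qed
  then show ?thesis using a1 fix_a by blast
qed

text \<open>A function in \<open>H\<^sub>b\<close> may be unbounded on the unit ball, but its composition with \<open>\<phi>\<close> only sees
  values on the ball of radius \<open>r\<close>. Dividing by \<open>M\<close> gives a disc function, so the estimate for disc
  functions yields the one for \<open>f\<close> with one application of \<open>\<phi>\<close> lost. The bound of \<open>f\<close> at \<open>x\<close> itself
  takes care of \<open>n = 0\<close>. Of \<open>f\<close>, only \<open>M\<close> enters the final bound, which makes it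
  uniform on bounded sets of functions.\<close>

lemma hb_iterates_geometric:
  fixes \<phi> :: "'h::complex_hilbert \<Rightarrow> 'h"
  assumes hol: "frechet_holomorphic_on \<phi> (ball 0 1)"
    and r: "0 < r" "r < 1" and maps: "\<phi> ` ball 0 1 \<subseteq> ball 0 r"
    and a: "a \<in> ball 0 1" "\<phi> a = a"
  obtains q K where "0 < q" "q < 1"
    "\<And>f M n x. M > 0 \<Longrightarrow> x \<in> ball 0 1 \<Longrightarrow> cmod (hb_apply f x) \<le> M \<Longrightarrow>
       (\<And>y. y \<in> ball 0 r \<Longrightarrow> cmod (hb_apply f y) \<le> M) \<Longrightarrow>
       cmod (hb_apply f ((\<phi> ^^ n) x) - hb_apply f a) \<le> M * K * q ^ n"
proof -
  obtain q K where q: "0 < q" "q < 1" and K: "K \<ge> 0"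
    and contr: "\<And>g n x y. g \<in> disc_functions \<Longrightarrow> x \<in> ball 0 1 \<Longrightarrow> y \<in> ball 0 1 \<Longrightarrow>
       cmod (g ((\<phi> ^^ n) x) - g ((\<phi> ^^ n) y)) \<le> K * q ^ n"
    using disc_functions_geometric_contraction[OF hol r maps] by blast
  have fix_n: "(\<phi> ^^ n) a = a" for n using a(2) by (induction n) auto
  have ar: "a \<in> ball 0 r" using maps a(1) a(2)[symmetric] by (simp only: image_subset_iff) metis
  have self: "\<phi> ` ball 0 1 \<subseteq> ball 0 1"
    using maps subset_ball[of r 1 0] r by (meson less_imp_le order_trans)
  show ?thesis
  proof (rule that[of q "2 + K / q"])
    fix f :: "'h hb" and M n x
    assume M: "M > 0" and x: "x \<in> ball 0 1" and fx: "cmod (hb_apply f x) \<le> M"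
      and f: "\<And>y. y \<in> ball 0 r \<Longrightarrow> cmod (hb_apply f y) \<le> M"
    show "cmod (hb_apply f ((\<phi> ^^ n) x) - hb_apply f a) \<le> M * (2 + K / q) * q ^ n"
    proof (cases n)
      case 0
      have "cmod (hb_apply f x - hb_apply f a) \<le> M * 2"
        using norm_triangle_ineq4[of "hb_apply f x" "hb_apply f a"] fx f[OF ar] by simp
      also have "\<dots> \<le> M * (2 + K / q)" using M K q by (intro mult_left_mono) auto
      finally show ?thesis using 0 by simp
    next
      case (Suc m)
      have "frechet_holomorphic_on (hb_apply f) (ball 0 1)"
        using hb_apply[of f] by (simp add: hb_functions_def)
      then have "frechet_holomorphic_on (\<lambda>z. hb_apply f (\<phi> z) / of_real M) (ball 0 1)"
        using frechet_holomorphic_on_divide[OF frechet_holomorphic_on_compose[OF hol _ self]] by blast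
      moreover have "cmod (hb_apply f (\<phi> z) / of_real M) \<le> 1" if "z \<in> ball 0 1" for z
        using f[of "\<phi> z"] that maps M by (simp add: norm_divide image_subset_iff)
      ultimately have g: "(\<lambda>z. hb_apply f (\<phi> z) / of_real M) \<in> disc_functions"
        by (simp add: disc_functions_def)
      have "cmod (hb_apply f ((\<phi> ^^ n) x) - hb_apply f a) / M \<le> K * q ^ m"
        using contr[OF g x a(1), of m] M fix_n[of m] a(2)
        by (simp add: Suc norm_divide flip: diff_divide_distrib)
      then have "cmod (hb_apply f ((\<phi> ^^ n) x) - hb_apply f a) \<le> M * (K / q) * q ^ n"
        using M q by (simp add: Suc field_simps)
      also have "\<dots> \<le> M * (2 + K / q) * q ^ n"
        using M K q by (intro mult_right_mono mult_left_mono) auto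
      finally show ?thesis .
    qed
  qed (use q in auto)
qed


section \<open>Continuous operators and bounded convergence\<close>

lemma continuous_operators_id: "(\<lambda>x. x) \<in> continuous_operators"
  by (simp add: continuous_operators_def complex_linear_def)

lemma continuous_operators_zero: "(\<lambda>x. 0) \<in> continuous_operators"
  by (simp add: continuous_operators_def complex_linear_def)

lemma continuous_operators_add:
  assumes "S \<in> continuous_operators" "T \<in> continuous_operators"
  shows "(\<lambda>x. S x + T x) \<in> continuous_operators"
  using assms unfolding continuous_operators_def complex_linear_def
  by (auto intro!: continuous_on_add simp: scaleC_add_right add_ac)

lemma continuous_operators_sum:
  assumes "\<And>i. i \<in> I \<Longrightarrow> T i \<in> continuous_operators"
  shows "(\<lambda>x. \<Sum>i\<in>I. T i x) \<in> continuous_operators"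
  using assms
  by (induction I rule: infinite_finite_induct)
    (auto intro: continuous_operators_zero continuous_operators_add)

lemma continuous_operators_scaleR:
  assumes "T \<in> continuous_operators"
  shows "(\<lambda>x. r *\<^sub>R T x) \<in> continuous_operators"
proof -
  have T: "complex_linear T" "continuous_on UNIV T"
    using assms by (simp_all add: continuous_operators_def)
  have "complex_linear (\<lambda>x. r *\<^sub>R T x)"
    using T(1) by (simp add: complex_linear_def scaleR_add_right scaleC_scaleR_commute)
  moreover have "continuous_on UNIV (\<lambda>x. r *\<^sub>R T x)"
    unfolding continuous_on_def
  proof
    fix x
    have "(T \<longlongrightarrow> T x) (at x)" using T(2) by (simp add: continuous_on_def)
    then have "filterlim (\<lambda>y. (complex_of_real r, T y)) (nhds (complex_of_real r) \<times>\<^sub>F nhds (T x)) (at x)"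
      by (intro filterlim_Pair tendsto_const)
    from filterlim_compose[OF tendsto_scaleC_Pair this]
    show "((\<lambda>x. r *\<^sub>R T x) \<longlongrightarrow> r *\<^sub>R T x) (at x)" by (simp add: scaleR_scaleC)
  qed
  ultimately show ?thesis by (simp add: continuous_operators_def)
qed

lemma continuous_operators_compose:
  assumes "S \<in> continuous_operators" "T \<in> continuous_operators"
  shows "(\<lambda>x. S (T x)) \<in> continuous_operators"
  using assms unfolding continuous_operators_def complex_linear_def
  by (auto intro: continuous_on_compose2)

lemma continuous_operators_funpow:
  assumes "T \<in> continuous_operators"
  shows "T ^^ n \<in> continuous_operators"
proof (induction n)
  case 0
  then show ?case using continuous_operators_id by (simp add: id_def)
next
  case (Suc n)
  then show ?case using continuous_operators_compose[OF assms Suc] by (simp add: o_def)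
qed

lemma continuous_operators_cesaro_mean:
  assumes "T \<in> continuous_operators"
  shows "cesaro_mean T n \<in> continuous_operators"
  unfolding cesaro_mean_def
  using assms by (intro continuous_operators_scaleR continuous_operators_sum continuous_operators_funpow)

lemma limitin_bounded_convergenceI:
  assumes P: "P \<in> continuous_operators"
    and T: "\<And>n. T n \<in> continuous_operators"
    and lim: "\<And>B U. lcs_bounded B \<Longrightarrow> open U \<Longrightarrow> 0 \<in> U \<Longrightarrow>
      \<forall>\<^sub>F n in F. \<forall>x\<in>B. T n x - P x \<in> U"
  shows "limitin bounded_convergence_topology T P F"
  unfolding limitin_def topspace_bounded_convergence_topology openin_bounded_convergence_topology
proof (intro conjI allI impI)
  fix W assume W: "bounded_convergence_open W \<and> P \<in> W"
  then obtain B U where BU: "lcs_bounded B" "open U" "0 \<in> U"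
      "{S \<in> continuous_operators. \<forall>x\<in>B. S x - P x \<in> U} \<subseteq> W"
    unfolding bounded_convergence_open_def by blast
  show "\<forall>\<^sub>F n in F. T n \<in> W"
    using lim[OF BU(1-3)] by eventually_elim (intro subsetD[OF BU(4)], simp add: T)
qed (fact P)

text \<open>Boundedness in \<open>H\<^sub>b\<close> gives uniform boundedness on each ball-bounded set: absorb the set of
  functions into the neighbourhood of zero given by the bound \<open>1\<close> on \<open>A\<close>.\<close>

lemma lcs_bounded_hb:
  fixes F :: "'h::complex_hilbert hb set"
  assumes F: "lcs_bounded F" and A: "ball_bounded A"
  obtains M where "M > 0" "\<And>f x. f \<in> F \<Longrightarrow> x \<in> A \<Longrightarrow> cmod (hb_apply f x) \<le> M"
proof -
  have "eventually (\<lambda>h. h \<in> hb_nbhd 0 A 1) (nhds 0)"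
    unfolding eventually_nhds_hb by (intro exI[of _ A] exI[of _ 1]) (simp add: A)
  then obtain U where U: "open U" "0 \<in> U" "\<And>h. h \<in> U \<Longrightarrow> h \<in> hb_nbhd 0 A 1"
    unfolding eventually_nhds by blast
  then have "\<exists>t>0. \<forall>s\<ge>t. F \<subseteq> (\<lambda>x. s *\<^sub>R x) ` U"
    using F by (simp add: lcs_bounded_def)
  then obtain t where t: "t > 0" "F \<subseteq> (\<lambda>x. t *\<^sub>R x) ` U" by blast
  have "cmod (hb_apply f x) \<le> t" if f: "f \<in> F" and x: "x \<in> A" for f x
  proof -
    obtain h where h: "h \<in> U" "f = t *\<^sub>R h" using t f by blast
    have "cmod (hb_apply h x) < 1" using U(3)[OF h(1)] x by (simp add: hb_nbhd_def hb_apply_zero)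
    then have "t * cmod (hb_apply h x) \<le> t * 1" using t(1) by (intro mult_left_mono) auto
    then show ?thesis using t(1) by (simp add: h(2) hb_apply_scaleR norm_mult)
  qed
  then show ?thesis using that t(1) by blast
qed

lemma limitin_bounded_convergence_hbI:
  fixes P :: "'h::complex_hilbert hb \<Rightarrow> 'h hb"
  assumes P: "P \<in> continuous_operators" and T: "\<And>n. T n \<in> continuous_operators"
    and rate: "\<And>F A. lcs_bounded F \<Longrightarrow> ball_bounded A \<Longrightarrow> \<exists>\<epsilon>. \<epsilon> \<longlonglongrightarrow> 0 \<and>
      (\<forall>n. \<forall>f\<in>F. \<forall>x\<in>A. cmod (hb_apply (T n f) x - hb_apply (P f) x) \<le> \<epsilon> n)"
  shows "limitin bounded_convergence_topology T P sequentially"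
proof (rule limitin_bounded_convergenceI[OF P T])
  fix F :: "'h hb set" and U :: "'h hb set"
  assume F: "lcs_bounded F" and U: "open U" "0 \<in> U"
  obtain A e where A: "ball_bounded A" "e > 0" "hb_nbhd 0 A e \<subseteq> U"
    using U unfolding open_hb_def by blast
  obtain \<epsilon> where \<epsilon>: "\<epsilon> \<longlonglongrightarrow> 0"
      "\<forall>n. \<forall>f\<in>F. \<forall>x\<in>A. cmod (hb_apply (T n f) x - hb_apply (P f) x) \<le> \<epsilon> n"
    using rate[OF F A(1)] by (elim exE conjE)
  have "\<forall>\<^sub>F n in sequentially. \<epsilon> n < e" using order_tendstoD(2)[OF \<epsilon>(1) A(2)] .
  then show "\<forall>\<^sub>F n in sequentially. \<forall>f\<in>F. T n f - P f \<in> U"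
  proof eventually_elim
    case (elim n)
    have "T n f - P f \<in> hb_nbhd 0 A e" if "f \<in> F" for f
      unfolding hb_nbhd_def
    proof (clarsimp simp: hb_apply_zero hb_apply_minus)
      fix x assume "x \<in> A"
      then have "cmod (hb_apply (T n f) x - hb_apply (P f) x) \<le> \<epsilon> n" using \<epsilon>(2) that by simp
      then show "cmod (hb_apply (T n f) x - hb_apply (P f) x) < e" using elim by simp
    qed
    then show ?case using A(3) by blast
  qed
qed


section \<open>Composition operators\<close>

lemma hb_apply_outside: "x \<notin> ball 0 1 \<Longrightarrow> hb_apply f x = 0"
  using hb_functionsD(3)[OF hb_apply] .

text \<open>Composition with such a symbol preserves \<open>H\<^sub>b\<close>. The class is closed under
  composition, and so contains the iterates of \<open>\<phi>\<close>, including the identity, although the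
  identity need not map the unit ball into a smaller one.\<close>

definition bounded_type_symbol :: "('h::complex_hilbert \<Rightarrow> 'h) \<Rightarrow> bool" where
  "bounded_type_symbol \<psi> \<longleftrightarrow> frechet_holomorphic_on \<psi> (ball 0 1) \<and> \<psi> ` ball 0 1 \<subseteq> ball 0 1 \<and>
     (\<forall>A. ball_bounded A \<longrightarrow> ball_bounded (\<psi> ` A))"

lemma hb_apply_comp_op_symbol:
  assumes "bounded_type_symbol \<psi>"
  shows "x \<in> ball 0 1 \<Longrightarrow> hb_apply (comp_op \<psi> f) x = hb_apply f (\<psi> x)"
  using assms unfolding bounded_type_symbol_def by (intro hb_apply_comp_op) blast+

lemma comp_op_eqI:
  assumes "bounded_type_symbol \<psi>" "\<And>x. x \<in> ball 0 1 \<Longrightarrow> hb_apply g x = hb_apply f (\<psi> x)"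
  shows "comp_op \<psi> f = g"
proof (rule hb_eqI)
  fix x show "hb_apply (comp_op \<psi> f) x = hb_apply g x"
    using assms hb_apply_comp_op_symbol hb_apply_outside by metis
qed

text \<open>For continuity, uniform convergence of \<open>g \<circ> \<psi>\<close> on \<open>A\<close> is uniform convergence of \<open>g\<close> on the image
  of \<open>A\<close>, which is again ball-bounded.\<close>

lemma comp_op_continuous_operators:
  fixes \<psi> :: "'h::complex_hilbert \<Rightarrow> 'h"
  assumes \<psi>: "bounded_type_symbol \<psi>"
  shows "comp_op \<psi> \<in> continuous_operators"
proof -
  have "complex_linear (comp_op \<psi>)"
    unfolding complex_linear_def
    by (auto intro!: comp_op_eqI[OF \<psi>]
        simp: hb_apply_add hb_apply_scaleC hb_apply_comp_op_symbol[OF \<psi>] simp del: mem_ball mem_ball_0)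
  moreover have "continuous_on UNIV (comp_op \<psi>)"
    unfolding continuous_on_def
  proof
    fix f :: "'h hb"
    have id: "((\<lambda>g. g) \<longlongrightarrow> f) (at f)" by simp
    show "(comp_op \<psi> \<longlongrightarrow> comp_op \<psi> f) (at f within UNIV)"
      unfolding tendsto_hb_iff
    proof (intro allI impI)
      fix A :: "'h set" assume A: "ball_bounded A"
      have "ball_bounded (\<psi> ` A)" using \<psi> A by (simp add: bounded_type_symbol_def)
      then have "uniform_limit (\<psi> ` A) hb_apply (hb_apply f) (at f)"
        using id unfolding tendsto_hb_iff by blast
      then have "uniform_limit A (\<lambda>g x. hb_apply g (\<psi> x)) (\<lambda>x. hb_apply f (\<psi> x)) (at f)"
        by (simp add: uniform_limit_iff)
      moreover have "hb_apply (comp_op \<psi> g) x = hb_apply g (\<psi> x)" if "x \<in> A" for g x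
        using hb_apply_comp_op_symbol[OF \<psi>] ball_bounded_subset[OF A] that by blast
      ultimately show "uniform_limit A (\<lambda>g. hb_apply (comp_op \<psi> g)) (hb_apply (comp_op \<psi> f)) (at f within UNIV)"
        by (simp add: uniform_limit_iff)
    qed
  qed
  ultimately show ?thesis by (simp add: continuous_operators_def)
qed

lemma bounded_type_symbol_const: "a \<in> ball 0 1 \<Longrightarrow> bounded_type_symbol (\<lambda>_. a)"
  using ball_bounded_singleton ball_bounded_empty unfolding bounded_type_symbol_def
  by (auto simp: frechet_holomorphic_on_const image_constant_conv simp del: mem_ball mem_ball_0)

lemma bounded_type_symbol_id: "bounded_type_symbol (\<lambda>x. x)"
  by (auto simp: bounded_type_symbol_def frechet_holomorphic_on_id)

lemma bounded_type_symbol_compose: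
  assumes "bounded_type_symbol f" "bounded_type_symbol g"
  shows "bounded_type_symbol (\<lambda>x. g (f x))"
  using assms frechet_holomorphic_on_compose[of f "ball 0 1" g "ball 0 1"]
  unfolding bounded_type_symbol_def by (simp add: image_subset_iff flip: image_image)

lemma bounded_type_symbol_funpow:
  assumes "bounded_type_symbol \<phi>"
  shows "bounded_type_symbol (\<phi> ^^ n)"
proof (induction n)
  case 0
  then show ?case using bounded_type_symbol_id by (simp add: id_def)
next
  case (Suc n)
  then show ?case using bounded_type_symbol_compose[OF Suc assms] by (simp add: o_def)
qed

lemma comp_op_funpow:
  assumes \<phi>: "bounded_type_symbol \<phi>"
  shows "comp_op (\<phi> ^^ n) = comp_op \<phi> ^^ n"
proof (induction n)
  case 0
  have "comp_op (\<lambda>x. x) f = f" for f :: "'a hb"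
    by (rule comp_op_eqI[OF bounded_type_symbol_id refl])
  then show ?case by (simp add: id_def fun_eq_iff)
next
  case (Suc n)
  show ?case
  proof
    fix f
    have "comp_op (\<phi> ^^ Suc n) f = comp_op \<phi> (comp_op (\<phi> ^^ n) f)"
    proof (rule comp_op_eqI[OF bounded_type_symbol_funpow[OF \<phi>]])
      fix x :: 'a assume x: "x \<in> ball 0 1"
      then have "\<phi> x \<in> ball 0 1" using \<phi> unfolding bounded_type_symbol_def by blast
      then show "hb_apply (comp_op \<phi> (comp_op (\<phi> ^^ n) f)) x = hb_apply f ((\<phi> ^^ Suc n) x)"
        using x by (simp add: hb_apply_comp_op_symbol \<phi> bounded_type_symbol_funpow funpow_Suc_right
            del: funpow.simps mem_ball mem_ball_0)
    qed
    then show "comp_op (\<phi> ^^ Suc n) f = (comp_op \<phi> ^^ Suc n) f" by (simp add: Suc)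
  qed
qed


section \<open>Cesaro means\<close>

lemma hb_apply_sum: "hb_apply (\<Sum>i\<in>I. f i) x = (\<Sum>i\<in>I. hb_apply (f i) x)"
  by (induction I rule: infinite_finite_induct) (simp_all add: hb_apply_zero hb_apply_add)

text \<open>The error of the mean is the mean of the errors, and these are bounded by a geometric series
  with sum \<open>C / (1 - q)\<close>.\<close>

lemma cesaro_error_le_geometric:
  fixes z :: "nat \<Rightarrow> complex"
  assumes z: "\<And>k. cmod (z k - p) \<le> C * q ^ k" and q: "0 < q" "q < 1" and n: "n > 0"
  shows "cmod (of_real (1 / real n) * (\<Sum>k<n. z k) - p) \<le> C / (1 - q) / n"
proof -
  have C: "C \<ge> 0" using order_trans[OF norm_ge_zero z[of 0]] by simp
  have "of_real (1 / real n) * (\<Sum>k<n. z k) - p = (\<Sum>k<n. z k - p) / of_nat n"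
    using n by (simp add: sum_subtractf field_simps)
  also have "cmod \<dots> = cmod (\<Sum>k<n. z k - p) / n" by (simp add: norm_divide)
  also have "\<dots> \<le> (\<Sum>k<n. C * q ^ k) / n"
    using z by (intro divide_right_mono sum_norm_le) auto
  also have "\<dots> = C * ((1 - q ^ n) / (1 - q)) / n"
    using q by (simp add: sum_distrib_left[symmetric] sum_gp_strict)
  also have "\<dots> \<le> C * (1 / (1 - q)) / n"
    using q C by (intro divide_right_mono mult_left_mono) auto
  finally show ?thesis by simp
qed

theorem proposition5p15:
  fixes \<phi> :: "'h::complex_hilbert \<Rightarrow> 'h" and r :: real
  assumes "frechet_holomorphic_on \<phi> (ball 0 1)"
    and "\<phi> ` ball 0 1 \<subseteq> ball 0 1"
    and "0 < r" "r < 1"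
    and "\<phi> ` ball 0 1 \<subseteq> ball 0 r"
  shows "(\<exists>!a. a \<in> ball 0 1 \<and> \<phi> a = a) \<and>
    (\<forall>a. a \<in> ball 0 1 \<and> \<phi> a = a \<longrightarrow>
      limitin bounded_convergence_topology
        (\<lambda>n. comp_op (\<phi> ^^ n)) (comp_op (\<lambda>_. a)) sequentially \<and>
      limitin bounded_convergence_topology
        (cesaro_mean (comp_op \<phi>)) (comp_op (\<lambda>_. a)) sequentially) \<and>
    uniformly_mean_ergodic (comp_op \<phi>)"
proof -
  have ex: "\<exists>!a. a \<in> ball 0 1 \<and> \<phi> a = a" using earle_hamilton assms by blast
  have sym: "bounded_type_symbol \<phi>"
    unfolding bounded_type_symbol_def
  proof (intro conjI allI impI)
    fix A :: "'h set" assume "ball_bounded A"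
    then have "\<phi> ` A \<subseteq> ball 0 r" using assms(5) ball_bounded_subset by blast
    then show "ball_bounded (\<phi> ` A)" using assms(3,4) by (auto simp: ball_bounded_def)
  qed (use assms in auto)
  have cont: "comp_op \<phi> \<in> continuous_operators" using comp_op_continuous_operators[OF sym] .
  have lims: "limitin bounded_convergence_topology
        (\<lambda>n. comp_op (\<phi> ^^ n)) (comp_op (\<lambda>_. a)) sequentially"
      "limitin bounded_convergence_topology
        (cesaro_mean (comp_op \<phi>)) (comp_op (\<lambda>_. a)) sequentially"
    if a: "a \<in> ball 0 1" "\<phi> a = a" for a
  proof -
    have cont_a: "comp_op (\<lambda>_. a) \<in> continuous_operators"
      using comp_op_continuous_operators[OF bounded_type_symbol_const[OF a(1)]] .
    obtain q K where q: "0 < q" "q < 1" and est: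
      "\<And>f M n x. M > 0 \<Longrightarrow> x \<in> ball 0 1 \<Longrightarrow> cmod (hb_apply f x) \<le> M \<Longrightarrow>
         (\<And>y. y \<in> ball 0 r \<Longrightarrow> cmod (hb_apply f y) \<le> M) \<Longrightarrow>
         cmod (hb_apply f ((\<phi> ^^ n) x) - hb_apply f a) \<le> M * K * q ^ n"
      using hb_iterates_geometric[OF assms(1,3,4,5) a] by metis
    \<comment> \<open>One ball-bounded set containing both \<open>A\<close> and the ball of radius \<open>r\<close> supplies the bound \<open>M\<close>.\<close>
    have rate: "\<exists>C. \<forall>n. \<forall>f\<in>F. \<forall>x\<in>A.
        cmod (hb_apply (comp_op (\<phi> ^^ n) f) x - hb_apply (comp_op (\<lambda>_. a) f) x) \<le> C * q ^ n"
      if F: "lcs_bounded F" and A: "ball_bounded A" for F A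
    proof -
      have "ball_bounded (ball (0::'h) r)" using assms(3,4) by (auto simp: ball_bounded_def)
      then obtain M where M: "M > 0"
        "\<And>f x. f \<in> F \<Longrightarrow> x \<in> A \<union> ball 0 r \<Longrightarrow> cmod (hb_apply f x) \<le> M"
        using lcs_bounded_hb[OF F ball_bounded_Un[OF A]] by metis
      show ?thesis
      proof (intro exI[of _ "M * K"] allI ballI)
        fix n f x assume f: "f \<in> F" and x: "x \<in> A"
        have x1: "x \<in> ball 0 1" using ball_bounded_subset[OF A] x by blast
        show "cmod (hb_apply (comp_op (\<phi> ^^ n) f) x - hb_apply (comp_op (\<lambda>_. a) f) x) \<le> M * K * q ^ n"
          unfolding hb_apply_comp_op_symbol[OF bounded_type_symbol_funpow[OF sym] x1]
            hb_apply_comp_op_symbol[OF bounded_type_symbol_const[OF a(1)] x1]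
          using M f x by (intro est x1) auto
      qed
    qed
    show "limitin bounded_convergence_topology
        (\<lambda>n. comp_op (\<phi> ^^ n)) (comp_op (\<lambda>_. a)) sequentially"
    proof (rule limitin_bounded_convergence_hbI[OF cont_a])
      show "comp_op (\<phi> ^^ n) \<in> continuous_operators" for n
        using comp_op_continuous_operators[OF bounded_type_symbol_funpow[OF sym]] .
      fix F :: "'h hb set" and A :: "'h set" assume "lcs_bounded F" "ball_bounded A"
      then obtain C where C: "\<forall>n. \<forall>f\<in>F. \<forall>x\<in>A.
          cmod (hb_apply (comp_op (\<phi> ^^ n) f) x - hb_apply (comp_op (\<lambda>_. a) f) x) \<le> C * q ^ n"
        using rate by blast
      have "(\<lambda>n. C * q ^ n) \<longlonglongrightarrow> 0"
        using q by (intro tendsto_mult_right_zero LIMSEQ_realpow_zero) auto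
      with C show "\<exists>\<epsilon>. \<epsilon> \<longlonglongrightarrow> 0 \<and> (\<forall>n. \<forall>f\<in>F. \<forall>x\<in>A.
          cmod (hb_apply (comp_op (\<phi> ^^ n) f) x - hb_apply (comp_op (\<lambda>_. a) f) x) \<le> \<epsilon> n)"
        by blast
    qed
    \<comment> \<open>The mean at index \<open>0\<close> is the zero operator, for which the error estimate fails.\<close>
    have "limitin bounded_convergence_topology
        (\<lambda>n. cesaro_mean (comp_op \<phi>) (Suc n)) (comp_op (\<lambda>_. a)) sequentially"
    proof (rule limitin_bounded_convergence_hbI[OF cont_a])
      show "cesaro_mean (comp_op \<phi>) (Suc n) \<in> continuous_operators" for n
        using continuous_operators_cesaro_mean[OF cont] .
      fix F :: "'h hb set" and A :: "'h set" assume "lcs_bounded F" "ball_bounded A"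
      then obtain C where C: "\<And>n f x. f \<in> F \<Longrightarrow> x \<in> A \<Longrightarrow>
          cmod (hb_apply (comp_op (\<phi> ^^ n) f) x - hb_apply (comp_op (\<lambda>_. a) f) x) \<le> C * q ^ n"
        using rate by meson
      have "(\<lambda>n. C / (1 - q) / Suc n) \<longlonglongrightarrow> 0" by (intro lim_const_over_n[THEN LIMSEQ_Suc])
      moreover have "cmod (hb_apply (cesaro_mean (comp_op \<phi>) (Suc n) f) x - hb_apply (comp_op (\<lambda>_. a) f) x)
          \<le> C / (1 - q) / Suc n" if "f \<in> F" "x \<in> A" for n f x
        using cesaro_error_le_geometric[OF C[OF that] q, of "Suc n"]
        unfolding cesaro_mean_def hb_apply_scaleR hb_apply_sum comp_op_funpow[OF sym] by simp
      ultimately show "\<exists>\<epsilon>. \<epsilon> \<longlonglongrightarrow> 0 \<and> (\<forall>n. \<forall>f\<in>F. \<forall>x\<in>A.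
          cmod (hb_apply (cesaro_mean (comp_op \<phi>) (Suc n) f) x - hb_apply (comp_op (\<lambda>_. a) f) x) \<le> \<epsilon> n)"
        by blast
    qed
    then show "limitin bounded_convergence_topology
        (cesaro_mean (comp_op \<phi>)) (comp_op (\<lambda>_. a)) sequentially"
      unfolding limitin_def eventually_sequentially_Suc[where P = "\<lambda>n. cesaro_mean (comp_op \<phi>) n \<in> _"] .
  qed
  have "uniformly_mean_ergodic (comp_op \<phi>)"
    using ex cont lims(2) unfolding uniformly_mean_ergodic_def by blast
  with ex lims show ?thesis by blast
qed

end
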